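(* Let $r\ge 1$ be an integer and $0\le\epsilon<1$. Consider any perturbation $\hat V$ with strength $\epsilon$ and range $r$. Let $E_0^\uparrow\le E_1^\uparrow\le E_2^\uparrow$ be the three lowest eigenvalues, counted with multiplicity, of $\hat H_0+\hat V$. Then for all sufficiently large $N$, $$E_1^\uparrow-E_0^\uparrow\le\Big(\frac{2\epsilon}{1+\epsilon}\Big)^{\frac{N}{2r}}\qquad\text{and}\qquad E_2^\uparrow-E_1^\uparrow\ge 1-\epsilon-\Big(\frac{2\epsilon}{1+\epsilon}\Big)^{\frac{N}{2r}}.$$
   Context: Fix an integer $N\ge 2$. Let $c_1,\dots,c_{2N}$ be Majorana operators on the $2^N$-dimensional fermionic Fock space of $N$ modes. These are self-adjoint operators with $c_pc_q+c_qc_p=2\delta_{p,q}I$. Concretely, via the Jordan–Wigner map on $N$ qubits, $c_{2j-1}=Z_1\cdots Z_{j-1}X_j$ and $c_{2j}=Z_1\cdots Z_{j-1}Y_j$. The unperturbed Hamiltonian is $\hat H_0=\frac{i}{2}\sum_{j=1}^{N-1}c_{2j}c_{2j+1}$. A perturbation is an operator $\hat V=\frac{i}{4}\sum_{p,q=1}^{2N}V_{p,q}c_pc_q$, where $V$ is a real antisymmetric $2N\times 2N$ matrix. The perturbation has strength $\epsilon$ if $\|V\|\le\epsilon$ (operator norm of the matrix $V$). It has range $r$ if $V_{p,q}=0$ whenever $|p-q|>r$. *)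

theory Defs
  imports "HOL-Analysis.Analysis" "Jordan_Normal_Form.Char_Poly"
begin

definition kron :: "complex mat \<Rightarrow> complex mat \<Rightarrow> complex mat" where
  "kron A B = mat (dim_row A * dim_row B) (dim_col A * dim_col B)
     (\<lambda>(i, j). A $$ (i div dim_row B, j div dim_col B) * B $$ (i mod dim_row B, j mod dim_col B))"

definition tensor_list :: "complex mat list \<Rightarrow> complex mat" where
  "tensor_list Ms = foldr kron Ms (1\<^sub>m 1)"

definition pauli_X :: "complex mat" where
  "pauli_X = mat_of_rows_list 2 [[0, 1], [1, 0]]"
definition pauli_Y :: "complex mat" where
  "pauli_Y = mat_of_rows_list 2 [[0, -\<i>], [\<i>, 0]]"
definition pauli_Z :: "complex mat" where
  "pauli_Z = mat_of_rows_list 2 [[1, 0], [0, -1]]"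

definition jw_string :: "nat \<Rightarrow> nat \<Rightarrow> complex mat \<Rightarrow> complex mat" where
  "jw_string N j P = tensor_list (replicate (j - 1) pauli_Z @ [P] @ replicate (N - j) (1\<^sub>m 2))"

(* Majorana operator c_p, p = 1..2N (Jordan-Wigner):
   c_{2j-1} = Z_1...Z_{j-1} X_j,  c_{2j} = Z_1...Z_{j-1} Y_j *)
definition majorana :: "nat \<Rightarrow> nat \<Rightarrow> complex mat" where
  "majorana N p = (if odd p then jw_string N ((p + 1) div 2) pauli_X
                   else jw_string N (p div 2) pauli_Y)"

definition H0 :: "nat \<Rightarrow> complex mat" where
  "H0 N = mat (2 ^ N) (2 ^ N) (\<lambda>(a, b).
      (\<i> / 2) * (\<Sum>j\<in>{1..N - 1}. (majorana N (2 * j) * majorana N (2 * j + 1)) $$ (a, b)))"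

(* V-hat = (i/4) sum_{p,q=1}^{2N} V_{p,q} c_p c_q; the real matrix V is stored 0-based,
   i.e. V_{p,q} = V $$ (p - 1, q - 1) *)
definition Vhat :: "nat \<Rightarrow> real mat \<Rightarrow> complex mat" where
  "Vhat N V = mat (2 ^ N) (2 ^ N) (\<lambda>(a, b).
      (\<i> / 4) * (\<Sum>p\<in>{1..2 * N}. \<Sum>q\<in>{1..2 * N}.
          complex_of_real (V $$ (p - 1, q - 1)) * (majorana N p * majorana N q) $$ (a, b)))"

(* eigenvalues (roots of the characteristic polynomial) counted with multiplicity,
   sorted increasingly; for a Hermitian matrix they are real, so we take real parts *)
definition sorted_eigenvalues :: "complex mat \<Rightarrow> real list" where
  "sorted_eigenvalues H = sorted_list_of_multiset (image_mset Re (proots (char_poly H)))"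

definition vec_norm2 :: "real vec \<Rightarrow> real" where
  "vec_norm2 x = sqrt (\<Sum>i<dim_vec x. (x $ i)\<^sup>2)"

definition op_norm :: "real mat \<Rightarrow> real" where
  "op_norm V = Sup {vec_norm2 (V *\<^sub>v x) | x. dim_vec x = dim_col V \<and> vec_norm2 x \<le> 1}"

definition perturbation :: "nat \<Rightarrow> real \<Rightarrow> nat \<Rightarrow> real mat \<Rightarrow> bool" where
  "perturbation N eps r V \<longleftrightarrow>
     V \<in> carrier_mat (2 * N) (2 * N) \<and>
     (\<forall>i<2 * N. \<forall>j<2 * N. V $$ (i, j) = - V $$ (j, i)) \<and>
     op_norm V \<le> eps \<and>
     (\<forall>i<2 * N. \<forall>j<2 * N. r < nat \<bar>int i - int j\<bar> \<longrightarrow> V $$ (i, j) = 0)"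

end

theory Submission
  imports Defs
begin

text \<open>The Hamiltonian is the quadratic form \<open>(\<i>/4) \<Sum> A\<^sub>p\<^sub>q c\<^sub>p c\<^sub>q\<close> of the real antisymmetric matrix \<open>A = A\<^sub>0 + V\<close>.
  Rotating the Majorana operators to a basis in which \<open>A\<close> is a sum of blocks \<open>l\<^sub>k J\<close> turns it into
  \<open>\<Sum> (l\<^sub>k/2) D\<^sub>k\<close> with commuting involutions \<open>D\<^sub>k\<close> that realise every sign pattern exactly once. If
  \<open>l\<^sub>i \<le> l\<^sub>j\<close> are the two smallest \<open>l\<^sub>k\<close>, then the two lowest gaps are \<open>l\<^sub>i\<close> and \<open>l\<^sub>j - l\<^sub>i\<close>.

  The four-dimensional space belonging to \<open>l\<^sub>i\<close> and \<open>l\<^sub>j\<close> contains a unit vector that vanishes at both ends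
  of the chain; \<open>A\<^sub>0\<close> is isometric there, so \<open>l\<^sub>j \<ge> 1 - \<epsilon>\<close>. On the other hand
  \<open>u = \<Sum>\<^sub>k\<^sub>\<le>\<^sub>m (A\<^sub>0 V)\<^sup>k e\<^sub>0\<close> satisfies \<open>A u = V (A\<^sub>0 V)\<^sup>m e\<^sub>0\<close> as long as \<open>m (r + 1) < 2N\<close>, so
  \<open>l\<^sub>i \<le> \<epsilon>\<^sup>m\<^sup>+\<^sup>1\<close>; for the largest such \<open>m\<close> one has \<open>m + 1 \<ge> N/r\<close>, and \<open>\<epsilon>\<^sup>2 \<le> 2\<epsilon>/(1 + \<epsilon>)\<close>.\<close>

section \<open>Vectors and antisymmetric forms\<close>

definition ip :: "nat \<Rightarrow> (nat \<Rightarrow> real) \<Rightarrow> (nat \<Rightarrow> real) \<Rightarrow> real" where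
  "ip n x y = (\<Sum>i<n. x i * y i)"

definition mv :: "nat \<Rightarrow> (nat \<Rightarrow> nat \<Rightarrow> real) \<Rightarrow> (nat \<Rightarrow> real) \<Rightarrow> nat \<Rightarrow> real" where
  "mv n A x = (\<lambda>p. if p < n then \<Sum>q<n. A p q * x q else 0)"

lemma ip_cong: "(\<And>i. i < n \<Longrightarrow> x i = x' i) \<Longrightarrow> (\<And>i. i < n \<Longrightarrow> y i = y' i) \<Longrightarrow> ip n x y = ip n x' y'"
  unfolding ip_def by (intro sum.cong) auto

lemma ip_commute: "ip n x y = ip n y x"
  unfolding ip_def by (simp add: mult.commute)

lemma ip_add_left: "ip n (\<lambda>i. x i + y i) z = ip n x z + ip n y z"
  unfolding ip_def by (simp add: sum.distrib algebra_simps)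

lemma ip_scale_left: "ip n (\<lambda>i. a * x i) z = a * ip n x z"
  unfolding ip_def by (simp add: sum_distrib_left algebra_simps)

lemma ip_add_right: "ip n z (\<lambda>i. x i + y i) = ip n z x + ip n z y"
  unfolding ip_def by (simp add: sum.distrib algebra_simps)

lemma ip_scale_right: "ip n z (\<lambda>i. a * x i) = a * ip n z x"
  unfolding ip_def by (simp add: sum_distrib_left algebra_simps)

lemma ip_sum_right: "ip n z (\<lambda>i. \<Sum>k\<in>K. f k i) = (\<Sum>k\<in>K. ip n z (f k))"
  unfolding ip_def by (simp add: sum_distrib_left) (rule sum.swap)

lemma ip_sum_left: "ip n (\<lambda>i. \<Sum>k\<in>K. f k i) z = (\<Sum>k\<in>K. ip n (f k) z)"
  by (simp add: ip_commute[of n _ z] ip_sum_right)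

lemmas ip_linear = ip_add_left ip_add_right ip_scale_left ip_scale_right

lemma ip_nonneg: "0 \<le> ip n x x"
  unfolding ip_def by (intro sum_nonneg) auto

lemma ip_eq_0D: "ip n x x = 0 \<Longrightarrow> i < n \<Longrightarrow> x i = 0"
  unfolding ip_def by (subst (asm) sum_nonneg_eq_0_iff) auto

lemma mv_add: "mv n A (\<lambda>i. x i + y i) = (\<lambda>i. mv n A x i + mv n A y i)"
  unfolding mv_def by (auto simp: sum.distrib algebra_simps)

lemma mv_scale: "mv n A (\<lambda>i. a * x i) = (\<lambda>i. a * mv n A x i)"
  unfolding mv_def by (auto simp: sum_distrib_left algebra_simps)

lemma mv_sum: "mv n A (\<lambda>i. \<Sum>k\<in>K. f k i) = (\<lambda>i. \<Sum>k\<in>K. mv n A (f k) i)"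
proof
  fix i
  have "(\<Sum>q<n. A i q * (\<Sum>k\<in>K. f k q)) = (\<Sum>k\<in>K. \<Sum>q<n. A i q * f k q)"
    by (simp add: sum_distrib_left) (rule sum.swap)
  then show "mv n A (\<lambda>i. \<Sum>k\<in>K. f k i) i = (\<Sum>k\<in>K. mv n A (f k) i)"
    unfolding mv_def by simp
qed

lemma mv_add_mat: "mv n (\<lambda>p q. A p q + B p q) x = (\<lambda>i. mv n A x i + mv n B x i)"
  unfolding mv_def by (auto simp: sum.distrib algebra_simps)

lemma mv_cong: "(\<And>i. i < n \<Longrightarrow> x i = y i) \<Longrightarrow> mv n A x = mv n A y"
  unfolding mv_def by (intro ext if_cong sum.cong) auto

definition antisym_mat :: "nat \<Rightarrow> (nat \<Rightarrow> nat \<Rightarrow> real) \<Rightarrow> bool" where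
  "antisym_mat n A \<longleftrightarrow> (\<forall>p<n. \<forall>q<n. A p q = - A q p)"

lemma ip_mv_antisym:
  assumes "antisym_mat n A"
  shows "ip n x (mv n A y) = - ip n (mv n A x) y"
proof -
  have "ip n x (mv n A y) = (\<Sum>p<n. \<Sum>q<n. x p * A p q * y q)"
    unfolding ip_def mv_def by (intro sum.cong) (auto simp: sum_distrib_left algebra_simps)
  also have "\<dots> = (\<Sum>q<n. \<Sum>p<n. x p * A p q * y q)"
    by (rule sum.swap)
  also have "\<dots> = (\<Sum>q<n. \<Sum>p<n. - (A q p * x p * y q))"
  proof (intro sum.cong refl)
    fix q p assume "q \<in> {..<n}" "p \<in> {..<n}"
    then have "A p q = - A q p" using assms unfolding antisym_mat_def by blast
    then show "x p * A p q * y q = - (A q p * x p * y q)" by (simp only:) simp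
  qed
  also have "\<dots> = - ip n (mv n A x) y"
    unfolding ip_def mv_def by (simp add: sum_distrib_right sum_negf)
  finally show ?thesis .
qed

lemma ip_mv_self_antisym: "antisym_mat n A \<Longrightarrow> ip n x (mv n A x) = 0"
  using ip_mv_antisym[of n A x x] by (simp add: ip_commute)

section \<open>Unit vectors under linear constraints, and norm maximisers among them\<close>

lemma exists_orthogonal_unit_vector:
  fixes f :: "nat \<Rightarrow> nat \<Rightarrow> real"
  assumes "m < n"
  shows "\<exists>x. ip n x x = 1 \<and> (\<forall>i<m. ip n (f i) x = 0)"
proof -
  \<comment> \<open>Fewer constraints than dimensions: the square matrix carrying them in its rows
    has the zero row \<open>m\<close>, hence determinant zero, and a kernel vector meets all
    constraints.\<close>
  define B where "B = mat\<^sub>r n n (\<lambda>i. if i = m then 0\<^sub>v n else vec n (\<lambda>j. if i < m then f i j else 0))"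
  have B: "B \<in> carrier_mat n n" unfolding B_def by auto
  have "det B = 0" unfolding B_def by (rule det_row_0[OF assms]) auto
  then obtain v where v: "v \<in> carrier_vec n" "v \<noteq> 0\<^sub>v n" "B *\<^sub>v v = 0\<^sub>v n"
    using det_0_iff_vec_prod_zero_field[OF B] by auto
  define y where "y = (\<lambda>i. v $ i)"
  have orth: "ip n (f i) y = 0" if "i < m" for i
  proof -
    have "(B *\<^sub>v v) $ i = ip n (f i) y"
      using v(1) B that assms unfolding ip_def y_def B_def
      by (auto simp: scalar_prod_def row_def atLeast0LessThan intro!: sum.cong)
    then show ?thesis using v(3) that assms by auto
  qed
  have "ip n y y \<noteq> 0"
  proof
    assume "ip n y y = 0"
    then have "v = 0\<^sub>v n" using v(1) ip_eq_0D[of n y] by (intro eq_vecI) (auto simp: y_def)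
    then show False using v(2) by simp
  qed
  then have pos: "ip n y y > 0" using ip_nonneg[of n y] by linarith
  define x where "x = (\<lambda>i. (1 / sqrt (ip n y y)) * y i)"
  have "ip n x x = 1" unfolding x_def ip_linear using pos by (simp add: field_simps)
  moreover have "ip n (f i) x = 0" if "i < m" for i
    unfolding x_def ip_linear using orth[OF that] by simp
  ultimately show ?thesis by blast
qed

text \<open>Vectors are functions on all naturals with the product topology. Forcing the coordinates
  from \<open>n\<close> on to be zero puts the set into a product of compact intervals, where
  Tychonoff applies; the remaining conditions are closed.\<close>

lemma compact_unit_vectors:
  "compact {x :: nat \<Rightarrow> real. (\<forall>i\<ge>n. x i = 0) \<and> ip n x x = 1 \<and> (\<forall>i<m. ip n (f i) x = 0)}"
    (is "compact ?S")
proof -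
  define B where "B = (\<lambda>i. if i < n then {-1..1::real} else {0})"
  have "compact (PiE UNIV B)"
    using compactin_PiE[of "\<lambda>_. euclidean" UNIV B]
    by (simp add: euclidean_product_topology compactin_euclidean_iff B_def)
  moreover have "closed {x :: nat \<Rightarrow> real. ip n x x = 1 \<and> (\<forall>i<m. ip n (f i) x = 0)}"
  proof -
    have "continuous_on UNIV (\<lambda>x :: nat \<Rightarrow> real. ip n x x)"
      "continuous_on UNIV (\<lambda>x :: nat \<Rightarrow> real. ip n (f i) x)" for i
      unfolding ip_def by (intro continuous_intros continuous_on_product_coordinates)+
    then show ?thesis
      by (intro closed_Collect_conj closed_Collect_all closed_Collect_imp closed_Collect_eq)
        (auto intro: continuous_intros)
  qed
  ultimately have "compact (PiE UNIV B \<inter> {x. ip n x x = 1 \<and> (\<forall>i<m. ip n (f i) x = 0)})"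
    by (rule compact_Int_closed)
  moreover have "?S = PiE UNIV B \<inter> {x. ip n x x = 1 \<and> (\<forall>i<m. ip n (f i) x = 0)}"
  proof (intro Set.set_eqI iffI)
    fix x assume x: "x \<in> ?S"
    have "\<bar>x i\<bar> \<le> 1" if "i < n" for i
    proof -
      have "(x i)\<^sup>2 \<le> ip n x x" unfolding ip_def power2_eq_square
        using that by (intro member_le_sum) auto
      then show ?thesis using x by (simp add: abs_square_le_1)
    qed
    then have "x i \<in> B i" for i using x by (auto simp: B_def abs_le_iff minus_le_iff)
    then show "x \<in> PiE UNIV B \<inter> {x. ip n x x = 1 \<and> (\<forall>i<m. ip n (f i) x = 0)}"
      using x by auto
  next
    fix x assume x: "x \<in> PiE UNIV B \<inter> {x. ip n x x = 1 \<and> (\<forall>i<m. ip n (f i) x = 0)}"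
    then have "x i \<in> B i" for i by auto
    then have "x i = 0" if "i \<ge> n" for i using that by (metis B_def leD singletonD)
    then show "x \<in> ?S" using x by blast
  qed
  ultimately show ?thesis by simp
qed

lemma exists_norm_maximizer:
  assumes "m < n"
  shows "\<exists>x. ip n x x = 1 \<and> (\<forall>i<m. ip n (f i) x = 0) \<and>
     (\<forall>y. ip n y y = 1 \<and> (\<forall>i<m. ip n (f i) y = 0) \<longrightarrow>
        ip n (mv n A y) (mv n A y) \<le> ip n (mv n A x) (mv n A x))"
proof -
  define S where "S = {x :: nat \<Rightarrow> real. (\<forall>i\<ge>n. x i = 0) \<and> ip n x x = 1 \<and> (\<forall>i<m. ip n (f i) x = 0)}"
  \<comment> \<open>Truncation moves any competitor into the compact set \<open>S\<close> without
    changing a value of \<open>ip\<close> or \<open>mv\<close>, so the maximum over \<open>S\<close>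
    is a maximum over all competitors.\<close>
  define cut where "cut = (\<lambda>x i. if i < n then x i else 0 :: real)"
  have cut: "ip n (cut x) z = ip n x z" "ip n z (cut y) = ip n z y" "mv n A (cut x) = mv n A x" for x y z
    unfolding cut_def by (auto intro: ip_cong mv_cong)
  have cutS: "cut y \<in> S" if "ip n y y = 1" "\<forall>i<m. ip n (f i) y = 0" for y
    using that unfolding S_def mem_Collect_eq cut by (simp add: cut_def)
  have "S \<noteq> {}" using exists_orthogonal_unit_vector[OF assms, of f] cutS by blast
  moreover have "compact S" unfolding S_def by (rule compact_unit_vectors)
  moreover have "continuous_on S (\<lambda>x. ip n (mv n A x) (mv n A x))"
  proof -
    have "ip n (mv n A x) (mv n A x) = (\<Sum>p<n. (\<Sum>q<n. A p q * x q) * (\<Sum>q<n. A p q * x q))" for x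
      unfolding ip_def mv_def by (intro sum.cong) auto
    moreover have "continuous_on UNIV (\<lambda>x. \<Sum>p<n. (\<Sum>q<n. A p q * x q) * (\<Sum>q<n. A p q * x q))"
      by (intro continuous_on_sum continuous_on_mult continuous_on_const continuous_on_product_coordinates)
    ultimately show ?thesis using continuous_on_subset by fastforce
  qed
  ultimately obtain x where x: "x \<in> S"
    "\<And>y. y \<in> S \<Longrightarrow> ip n (mv n A y) (mv n A y) \<le> ip n (mv n A x) (mv n A x)"
    using continuous_attains_sup[of S "\<lambda>x. ip n (mv n A x) (mv n A x)"] by auto
  have "ip n (mv n A y) (mv n A y) \<le> ip n (mv n A x) (mv n A x)"
    if "ip n y y = 1" "\<forall>i<m. ip n (f i) y = 0" for y
    using x(2)[OF cutS[OF that]] by (simp only: cut)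
  then show ?thesis using x(1) unfolding S_def by blast
qed

section \<open>Canonical form of a real antisymmetric matrix\<close>

text \<open>This is the first-order condition at a maximum: a perturbation of size \<open>t\<close>
  cannot have a nonzero linear term if it is dominated by a quadratic one.\<close>

lemma quadratic_domination_zero:
  fixes a b :: real
  assumes "\<And>t. 2 * t * a \<le> t\<^sup>2 * b" and "b \<ge> 0"
  shows "a = 0"
proof -
  \<comment> \<open>With this \<open>t\<close> the hypothesis collapses to
    \<open>t\<^sup>2 * (b + 2) \<le> 0\<close>. The denominator \<open>b + 1\<close> stays positive
    even for \<open>b = 0\<close>.\<close>
  define t where "t = a / (b + 1)"
  have a: "a = t * (b + 1)" using assms(2) by (simp add: t_def)
  have "t\<^sup>2 * (b + 2) \<le> 0" using assms(1)[of t] by (simp add: a algebra_simps power2_eq_square)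
  then have "t = 0" using assms(2) by (simp add: mult_le_0_iff)
  then show ?thesis using a by simp
qed

text \<open>Maximise the length of \<open>A y\<close> over the unit vectors \<open>y\<close>
  orthogonal to the \<open>F i\<close>. At a maximiser \<open>f\<close> with squared length
  \<open>L\<close> of \<open>A f\<close>, stationarity makes \<open>f\<close> an eigenvector of
  \<open>- A\<^sup>2\<close> for \<open>L\<close> on that invariant complement, and the normalised
  image of \<open>f\<close> under \<open>A\<close> completes the invariant plane.\<close>

lemma exists_antisym_pair:
  assumes A: "antisym_mat n A" and m: "Suc m < n"
    and inv: "\<And>y. \<forall>i<m. ip n (F i) y = 0 \<Longrightarrow> \<forall>i<m. ip n (F i) (mv n A y) = 0"
  shows "\<exists>f g l. 0 \<le> l \<and> ip n f f = 1 \<and> ip n g g = 1 \<and> ip n f g = 0 \<and>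
     (\<forall>i<m. ip n (F i) f = 0 \<and> ip n (F i) g = 0) \<and>
     (\<forall>p<n. mv n A f p = l * g p \<and> mv n A g p = - l * f p)"
proof -
  define W where "W y \<longleftrightarrow> (\<forall>i<m. ip n (F i) y = 0)" for y
  have W_lin: "W (\<lambda>i. a * x i + b * y i)" if "W x" "W y" for x y a b
    using that by (simp add: W_def ip_linear)
  have W_scale: "W (\<lambda>i. a * x i)" if "W x" for x a
    using that by (simp add: W_def ip_linear)
  have W_mv: "W (mv n A y)" if "W y" for y
    using inv[of y] that by (simp add: W_def)
  obtain f where f: "ip n f f = 1" "W f"
    and max: "\<And>y. ip n y y = 1 \<Longrightarrow> W y \<Longrightarrow> ip n (mv n A y) (mv n A y) \<le> ip n (mv n A f) (mv n A f)"
    using exists_norm_maximizer[of m n F A] m unfolding W_def by auto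
  define L where "L = ip n (mv n A f) (mv n A f)"
  have L0: "L \<ge> 0" unfolding L_def by (rule ip_nonneg)
  have bound: "ip n (mv n A y) (mv n A y) \<le> L * ip n y y" if "W y" for y
  proof (cases "ip n y y = 0")
    case True
    then have "mv n A y = mv n A (\<lambda>i. 0 * y i)"
      using ip_eq_0D[OF True] by (intro mv_cong) auto
    then have "mv n A y = (\<lambda>i. 0)" unfolding mv_scale by simp
    then show ?thesis using True by (simp add: ip_def)
  next
    case False
    then have pos: "ip n y y > 0" using ip_nonneg[of n y] by linarith
    define a where "a = 1 / sqrt (ip n y y)"
    have a: "a * a * ip n y y = 1" using pos unfolding a_def by simp
    have "ip n (mv n A (\<lambda>i. a * y i)) (mv n A (\<lambda>i. a * y i)) \<le> L"
      unfolding L_def using a that by (intro max W_scale) (simp_all add: ip_linear mult.assoc)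
    then have "a * a * ip n (mv n A y) (mv n A y) \<le> L"
      by (simp add: mv_scale ip_linear mult.assoc)
    then have "a * a * ip n (mv n A y) (mv n A y) * ip n y y \<le> L * ip n y y"
      using pos by (simp add: mult_right_mono)
    moreover have "a * a * ip n (mv n A y) (mv n A y) * ip n y y
        = (a * a * ip n y y) * ip n (mv n A y) (mv n A y)" by simp
    ultimately show ?thesis using a by simp
  qed
  \<comment> \<open>Stationarity: \<open>f + t h\<close> is an admissible competitor for every
    \<open>t\<close>, and comparing the terms linear in \<open>t\<close> gives the identity.\<close>
  have var: "ip n (mv n A f) (mv n A h) = L * ip n f h" if h: "W h" for h
  proof -
    have "ip n (mv n A f) (mv n A h) - L * ip n f h = 0"
    proof (rule quadratic_domination_zero)
      fix t :: real
      define y where "y = (\<lambda>i. f i + t * h i)"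
      have "W y" unfolding y_def using W_lin[OF f(2) h, of 1 t] by simp
      from bound[OF this] have "L + 2 * t * ip n (mv n A f) (mv n A h) + t\<^sup>2 * ip n (mv n A h) (mv n A h)
         \<le> L * (1 + 2 * t * ip n f h + t\<^sup>2 * ip n h h)"
        unfolding y_def mv_add mv_scale ip_linear f(1) L_def[symmetric]
        by (simp add: ip_commute[of n h f] ip_commute[of n "mv n A h" "mv n A f"] algebra_simps power2_eq_square)
      then show "2 * t * (ip n (mv n A f) (mv n A h) - L * ip n f h)
         \<le> t\<^sup>2 * (L * ip n h h - ip n (mv n A h) (mv n A h))"
        by (simp add: algebra_simps)
    qed (use bound[OF h] in simp)
    then show ?thesis by simp
  qed
  show ?thesis
  proof (cases "L = 0")
    \<comment> \<open>Here \<open>A\<close> vanishes on the whole complement, so any unit vector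
      orthogonal to \<open>f\<close> in it serves as partner. It exists because \<open>f\<close> is
      only one more constraint and \<open>Suc m < n\<close>.\<close>
    case True
    obtain g where g: "ip n g g = 1" "\<And>i. i < Suc m \<Longrightarrow> ip n ((F(m := f)) i) g = 0"
      using exists_orthogonal_unit_vector[OF m, of "F(m := f)"] by auto
    have fg: "ip n f g = 0" using g(2)[of m] by simp
    have Fg: "ip n (F i) g = 0" if "i < m" for i using g(2)[of i] that by simp
    then have "W g" by (simp add: W_def)
    have "ip n (mv n A y) (mv n A y) = 0" if "W y" for y
      using bound[OF that] True ip_nonneg[of n "mv n A y"] by simp
    then have "mv n A f p = 0" "mv n A g p = 0" if "p < n" for p
      using f(2) \<open>W g\<close> that ip_eq_0D by blast+
    then show ?thesis using f g(1) fg Fg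
      by (intro exI[of _ f] exI[of _ g] exI[of _ 0]) (auto simp: W_def)
  next
    case False
    define l where "l = sqrt L"
    have l: "l > 0" "l * l = L" using False L0 by (auto simp: l_def)
    define g where "g = (\<lambda>i. (1 / l) * mv n A f i)"
    have Wg: "W g" unfolding g_def by (intro W_scale W_mv f)
    have gg: "ip n g g = 1" unfolding g_def ip_linear using l False
      by (simp add: L_def[symmetric] field_simps)
    have fg: "ip n f g = 0" unfolding g_def ip_linear using ip_mv_self_antisym[OF A] by simp
    \<comment> \<open>The defect of the second relation. Antisymmetry and \<open>var\<close> turn
      the pairing of \<open>A g\<close> with \<open>z\<close> into \<open>- l\<close> times that of
      \<open>f\<close> with \<open>z\<close>, so \<open>z\<close> has norm zero.\<close>
    define z where "z = (\<lambda>i. mv n A g i + l * f i)"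
    have Wz: "W z" unfolding z_def using W_lin[OF W_mv[OF Wg] f(2), of 1 l] by simp
    have "ip n z z = ip n (mv n A g) z + l * ip n f z"
      by (subst (1) z_def) (simp add: ip_linear)
    also have "ip n (mv n A g) z = - ip n g (mv n A z)"
      using ip_mv_antisym[OF A, of g z] by simp
    also have "ip n g (mv n A z) = (1 / l) * (L * ip n f z)"
      unfolding g_def ip_linear var[OF Wz] ..
    also have "\<dots> = l * ip n f z" using l by (simp add: field_simps)
    finally have "ip n z z = 0" by simp
    then have "mv n A g p = - l * f p" if "p < n" for p
      using ip_eq_0D[of n z p] that by (simp add: z_def)
    moreover have "mv n A f p = l * g p" for p using l by (simp add: g_def)
    ultimately show ?thesis using f Wg gg fg l
      by (intro exI[of _ f] exI[of _ g] exI[of _ l]) (auto simp: W_def)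
  qed
qed

definition orthonormal :: "nat \<Rightarrow> nat \<Rightarrow> (nat \<Rightarrow> nat \<Rightarrow> real) \<Rightarrow> bool" where
  "orthonormal n m F \<longleftrightarrow> (\<forall>i<m. \<forall>j<m. ip n (F i) (F j) = (if i = j then 1 else 0))"

text \<open>Invariant planes are split off one at a time. \<open>A\<close> maps the planes already
  found into themselves, so by antisymmetry it also preserves their orthogonal complement, which
  still has at least two dimensions as long as fewer than \<open>N\<close> planes are found.\<close>

lemma antisym_canonical_basis_aux:
  assumes A: "antisym_mat (2 * N) A" and "k \<le> N"
  shows "\<exists>F l. orthonormal (2 * N) (2 * k) F \<and> (\<forall>i<k. 0 \<le> l i \<and> (\<forall>p<2 * N.
      mv (2 * N) A (F (2 * i)) p = l i * F (2 * i + 1) p \<and>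
      mv (2 * N) A (F (2 * i + 1)) p = - l i * F (2 * i) p))"
  using \<open>k \<le> N\<close>
proof (induction k)
  case 0
  then show ?case by (auto simp: orthonormal_def)
next
  case (Suc k)
  let ?n = "2 * N"
  obtain F l where F: "orthonormal ?n (2 * k) F" and l: "\<And>i. i < k \<Longrightarrow> 0 \<le> l i"
    and AF: "\<And>i p. i < k \<Longrightarrow> p < ?n \<Longrightarrow> mv ?n A (F (2 * i)) p = l i * F (2 * i + 1) p"
      "\<And>i p. i < k \<Longrightarrow> p < ?n \<Longrightarrow> mv ?n A (F (2 * i + 1)) p = - l i * F (2 * i) p"
    using Suc.IH Suc.prems by (auto simp del: mult_minus_left)
  have inv: "\<forall>i<2 * k. ip ?n (F i) (mv ?n A y) = 0" if y: "\<forall>i<2 * k. ip ?n (F i) y = 0" for y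
  proof (intro allI impI)
    fix i assume i: "i < 2 * k"
    have *: "ip ?n (F i) (mv ?n A y) = - ip ?n (mv ?n A (F i)) y" by (rule ip_mv_antisym[OF A])
    show "ip ?n (F i) (mv ?n A y) = 0"
    proof (cases "even i")
      case True
      then obtain j where j: "i = 2 * j" by (elim evenE)
      have "ip ?n (mv ?n A (F i)) y = ip ?n (\<lambda>p. l j * F (2 * j + 1) p) y"
        using i j AF(1)[of j] by (intro ip_cong) auto
      then show ?thesis using * y i j by (simp add: ip_linear)
    next
      case False
      then obtain j where j: "i = 2 * j + 1" by (elim oddE)
      have "ip ?n (mv ?n A (F i)) y = ip ?n (\<lambda>p. - l j * F (2 * j) p) y"
        using i j AF(2)[of j] by (intro ip_cong) auto
      then show ?thesis using * y i j unfolding ip_linear by simp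
    qed
  qed
  have "Suc (2 * k) < ?n" using Suc.prems by simp
  from exists_antisym_pair[OF A this inv]
  obtain f g c where fg: "0 \<le> c" "ip ?n f f = 1" "ip ?n g g = 1" "ip ?n f g = 0"
     "\<And>i. i < 2 * k \<Longrightarrow> ip ?n (F i) f = 0" "\<And>i. i < 2 * k \<Longrightarrow> ip ?n (F i) g = 0"
     "\<And>p. p < ?n \<Longrightarrow> mv ?n A f p = c * g p" "\<And>p. p < ?n \<Longrightarrow> mv ?n A g p = - c * f p"
    by blast
  define F' where "F' = F(2 * k := f, 2 * k + 1 := g)"
  define l' where "l' = l(k := c)"
  have F'1: "F' i = F i" if "i < 2 * k" for i using that by (simp add: F'_def)
  have F'2: "F' (2 * k) = f" "F' (2 * k + 1) = g" by (auto simp: F'_def)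
  have "orthonormal ?n (2 * Suc k) F'"
    unfolding orthonormal_def
  proof (intro allI impI)
    fix i j assume "i < 2 * Suc k" "j < 2 * Suc k"
    then have "i < 2 * k \<or> i = 2 * k \<or> i = 2 * k + 1" "j < 2 * k \<or> j = 2 * k \<or> j = 2 * k + 1"
      by presburger+
    then consider "i < 2 * k" "j < 2 * k" | "i < 2 * k" "j = 2 * k" | "i < 2 * k" "j = 2 * k + 1"
      | "i = 2 * k" "j < 2 * k" | "i = 2 * k" "j = 2 * k" | "i = 2 * k" "j = 2 * k + 1"
      | "i = 2 * k + 1" "j < 2 * k" | "i = 2 * k + 1" "j = 2 * k" | "i = 2 * k + 1" "j = 2 * k + 1"
      by blast
    then show "ip ?n (F' i) (F' j) = (if i = j then 1 else 0)"
      using F fg(2-6) ip_commute[of ?n f "F j"] ip_commute[of ?n g "F j"] ip_commute[of ?n g f]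
      by cases (simp_all only: F'1 F'2, auto simp: orthonormal_def)
  qed
  moreover have "0 \<le> l' i \<and> (\<forall>p<?n. mv ?n A (F' (2 * i)) p = l' i * F' (2 * i + 1) p \<and>
      mv ?n A (F' (2 * i + 1)) p = - l' i * F' (2 * i) p)" if "i < Suc k" for i
  proof (cases "i = k")
    case True
    then show ?thesis using fg F'2 by (simp add: l'_def)
  next
    case False
    then have "i < k" using that by simp
    then show ?thesis using AF l by (simp add: l'_def F'1)
  qed
  ultimately show ?case by blast
qed

text \<open>Orthonormal rows of a square matrix give a one-sided inverse, which is two-sided; so the
  columns are orthonormal too.\<close>

lemma orthonormal_complete:
  assumes "orthonormal n n F" "p < n" "q < n"
  shows "(\<Sum>i<n. F i p * F i q) = (if p = q then 1 else 0)"
proof -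
  define M where "M = mat n n (\<lambda>(i, j). F i j)"
  have M: "M \<in> carrier_mat n n" unfolding M_def by simp
  have "M * M\<^sup>T = 1\<^sub>m n"
    using assms(1) by (intro eq_matI)
      (auto simp: M_def scalar_prod_def orthonormal_def ip_def atLeast0LessThan)
  then have "M\<^sup>T * M = 1\<^sub>m n"
    using M by (intro mat_mult_left_right_inverse[of M n]) auto
  then have "(M\<^sup>T * M) $$ (p, q) = 1\<^sub>m n $$ (p, q)" by simp
  then show ?thesis using assms(2,3)
    by (simp add: M_def scalar_prod_def atLeast0LessThan)
qed

lemma sum_pairs: "(\<Sum>i<2 * N. h i) = (\<Sum>i<N. h (2 * i) + h (2 * i + 1))"
  for h :: "nat \<Rightarrow> 'a :: comm_monoid_add"
  by (induction N) (auto simp: add_ac)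

lemma antisym_canonical_form:
  assumes A: "antisym_mat (2 * N) A"
  obtains F l where "orthonormal (2 * N) (2 * N) F" "\<And>i. i < N \<Longrightarrow> 0 \<le> l i"
    "\<And>p q. p < 2 * N \<Longrightarrow> q < 2 * N \<Longrightarrow>
       A p q = (\<Sum>i<N. l i * (F (2 * i + 1) p * F (2 * i) q - F (2 * i) p * F (2 * i + 1) q))"
    "\<And>i p. i < N \<Longrightarrow> p < 2 * N \<Longrightarrow> mv (2 * N) A (F (2 * i)) p = l i * F (2 * i + 1) p"
    "\<And>i p. i < N \<Longrightarrow> p < 2 * N \<Longrightarrow> mv (2 * N) A (F (2 * i + 1)) p = - l i * F (2 * i) p"
proof -
  let ?n = "2 * N"
  obtain F l where F: "orthonormal ?n ?n F" and l: "\<And>i. i < N \<Longrightarrow> 0 \<le> l i"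
    and AF: "\<And>i p. i < N \<Longrightarrow> p < ?n \<Longrightarrow> mv ?n A (F (2 * i)) p = l i * F (2 * i + 1) p"
      "\<And>i p. i < N \<Longrightarrow> p < ?n \<Longrightarrow> mv ?n A (F (2 * i + 1)) p = - l i * F (2 * i) p"
    using antisym_canonical_basis_aux[OF A order_refl] by blast
  have "A p q = (\<Sum>i<N. l i * (F (2 * i + 1) p * F (2 * i) q - F (2 * i) p * F (2 * i + 1) q))"
    if pq: "p < ?n" "q < ?n" for p q
  proof -
    \<comment> \<open>Inserting the completeness relation writes \<open>A\<close> as the sum of the
      products of \<open>A F i\<close> with \<open>F i\<close>; the terms are then grouped by
      planes.\<close>
    have "A p q = (\<Sum>r<?n. A p r * (if r = q then 1 else 0))"
      using pq by (simp add: if_distrib cong: if_cong)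
    also have "\<dots> = (\<Sum>r<?n. A p r * (\<Sum>i<?n. F i r * F i q))"
      using orthonormal_complete[OF F _ pq(2)] by (intro sum.cong refl) simp
    also have "\<dots> = (\<Sum>r<?n. \<Sum>i<?n. A p r * F i r * F i q)"
      by (simp add: sum_distrib_left mult.assoc)
    also have "\<dots> = (\<Sum>i<?n. \<Sum>r<?n. A p r * F i r * F i q)" by (rule sum.swap)
    also have "\<dots> = (\<Sum>i<?n. mv ?n A (F i) p * F i q)"
      using pq by (simp add: mv_def sum_distrib_right)
    also have "\<dots> = (\<Sum>i<N. mv ?n A (F (2 * i)) p * F (2 * i) q + mv ?n A (F (2 * i + 1)) p * F (2 * i + 1) q)"
      by (rule sum_pairs)
    also have "\<dots> = (\<Sum>i<N. l i * (F (2 * i + 1) p * F (2 * i) q - F (2 * i) p * F (2 * i + 1) q))"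
    proof (intro sum.cong refl)
      fix i assume "i \<in> {..<N}"
      then have "i < N" by simp
      then show "mv ?n A (F (2 * i)) p * F (2 * i) q + mv ?n A (F (2 * i + 1)) p * F (2 * i + 1) q
        = l i * (F (2 * i + 1) p * F (2 * i) q - F (2 * i) p * F (2 * i + 1) q)"
        unfolding AF(1)[OF \<open>i < N\<close> pq(1)] AF(2)[OF \<open>i < N\<close> pq(1)] by (simp add: algebra_simps)
    qed
    finally show ?thesis .
  qed
  then show ?thesis using that F l AF by blast
qed

section \<open>Singular values of the perturbed chain\<close>

text \<open>The coefficient matrix of \<open>H0\<close> with 0-based indices: \<open>H0 N = (\<i>/4) \<Sum> chain (2 * N) p q c\<^sub>p\<^sub>+\<^sub>1 c\<^sub>q\<^sub>+\<^sub>1\<close>.\<close>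

definition chain :: "nat \<Rightarrow> nat \<Rightarrow> nat \<Rightarrow> real" where
  "chain n p q = (if odd p \<and> q = p + 1 \<and> q < n then 1 else if even p \<and> q + 1 = p then - 1 else 0)"

lemma antisym_mat_chain: "antisym_mat n (chain n)"
  unfolding antisym_mat_def chain_def by auto

lemma mv_chain:
  assumes "p < n"
  shows "mv n (chain n) x p =
    (if odd p then if p + 1 < n then x (p + 1) else 0 else if p = 0 then 0 else - x (p - 1))"
proof -
  have mv: "mv n (chain n) x p = (\<Sum>q<n. chain n p q * x q)" using assms by (simp add: mv_def)
  show ?thesis
  proof (cases "odd p")
    case True
    then have "(\<Sum>q<n. chain n p q * x q) = (\<Sum>q<n. if q = p + 1 then x q else 0)"
      by (intro sum.cong) (auto simp: chain_def)
    then show ?thesis using True mv by simp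
  next
    case False
    \<comment> \<open>At \<open>p = 0\<close> the subtraction \<open>p - 1\<close> yields
      \<open>0\<close>, a neighbour that does not exist; the inner case distinction removes
      it.\<close>
    then have "(\<Sum>q<n. chain n p q * x q) = (\<Sum>q<n. if q = p - 1 then if p = 0 then 0 else - x q else 0)"
      by (intro sum.cong) (auto simp: chain_def)
    then show ?thesis using False mv assms by simp
  qed
qed

text \<open>The chain pairs the sites 1-2, 3-4 and so on, acting on each pair as a quarter turn. For
  even \<open>n\<close> exactly the two end sites stay unpaired and are annihilated.\<close>

lemma mv_chain_chain:
  assumes "p < n" "even n"
  shows "mv n (chain n) (mv n (chain n) x) p = (if p = 0 \<or> p = n - 1 then 0 else - x p)"
proof -
  have "p + 1 < n" if "p \<noteq> n - 1" using that assms by linarith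
  moreover have "odd (n - 1)" using assms by auto
  ultimately show ?thesis using assms
    by (auto simp: mv_chain)
qed

lemma ip_mv_chain:
  assumes "even n"
  shows "ip n (mv n (chain n) x) (mv n (chain n) x) = (\<Sum>p<n. if p = 0 \<or> p = n - 1 then 0 else (x p)\<^sup>2)"
proof -
  have "ip n (mv n (chain n) x) (mv n (chain n) x) = - ip n x (mv n (chain n) (mv n (chain n) x))"
    using ip_mv_antisym[OF antisym_mat_chain, of n x "mv n (chain n) x"] by simp
  also have "\<dots> = (\<Sum>p<n. - (x p * mv n (chain n) (mv n (chain n) x) p))"
    by (simp add: ip_def sum_negf)
  also have "\<dots> = (\<Sum>p<n. if p = 0 \<or> p = n - 1 then 0 else (x p)\<^sup>2)"
    using assms by (intro sum.cong refl) (simp add: mv_chain_chain power2_eq_square)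
  finally show ?thesis .
qed

lemma ip_mv_chain_le: "even n \<Longrightarrow> ip n (mv n (chain n) x) (mv n (chain n) x) \<le> ip n x x"
  unfolding ip_mv_chain by (auto simp: ip_def power2_eq_square intro!: sum_mono)

lemma ip_mv_chain_eq:
  assumes "even n" "x 0 = 0" "x (n - 1) = 0"
  shows "ip n (mv n (chain n) x) (mv n (chain n) x) = ip n x x"
  unfolding ip_mv_chain[OF assms(1)] using assms(2,3)
  by (auto simp: ip_def power2_eq_square intro!: sum.cong)

section \<open>Orthonormal expansions and bounds for the singular values\<close>

lemma ip_orthonormal_comb:
  assumes "orthonormal n m b"
  shows "ip n (\<lambda>p. \<Sum>k<m. a k * b k p) (\<lambda>p. \<Sum>k<m. a k * b k p) = (\<Sum>k<m. (a k)\<^sup>2)"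
proof -
  have "ip n (\<lambda>p. \<Sum>k<m. a k * b k p) (\<lambda>p. \<Sum>k<m. a k * b k p)
      = (\<Sum>k<m. a k * (\<Sum>j<m. a j * ip n (b k) (b j)))"
    by (simp add: ip_sum_left ip_sum_right ip_linear sum_distrib_left)
  also have "\<dots> = (\<Sum>k<m. a k * (\<Sum>j<m. a j * (if k = j then 1 else 0)))"
    using assms by (intro sum.cong refl arg_cong2[where f = "(*)"]) (auto simp: orthonormal_def)
  also have "\<dots> = (\<Sum>k<m. (a k)\<^sup>2)"
    by (simp add: if_distrib power2_eq_square cong: if_cong)
  finally show ?thesis .
qed

lemma parseval:
  assumes "orthonormal n n F"
  shows "ip n y y = (\<Sum>i<n. (ip n (F i) y)\<^sup>2)"
proof -
  have "(\<Sum>i<n. (ip n (F i) y)\<^sup>2) = (\<Sum>i<n. \<Sum>p<n. \<Sum>q<n. y p * y q * (F i p * F i q))"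
    unfolding ip_def power2_eq_square sum_product by (simp add: algebra_simps)
  also have "\<dots> = (\<Sum>p<n. \<Sum>i<n. \<Sum>q<n. y p * y q * (F i p * F i q))" by (rule sum.swap)
  also have "\<dots> = (\<Sum>p<n. \<Sum>q<n. \<Sum>i<n. y p * y q * (F i p * F i q))"
    by (intro sum.cong refl sum.swap)
  also have "\<dots> = (\<Sum>p<n. \<Sum>q<n. y p * y q * (if p = q then 1 else 0))"
    using orthonormal_complete[OF assms] by (intro sum.cong refl) (simp flip: sum_distrib_left)
  also have "\<dots> = ip n y y" by (simp add: ip_def if_distrib cong: if_cong)
  finally show ?thesis ..
qed

lemma L2_set_eq_sqrt_ip: "L2_set x {..<n} = sqrt (ip n x x)"
  by (simp add: L2_set_def ip_def power2_eq_square)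

text \<open>The \<open>l i\<close> are the singular values of \<open>A\<close>, each carried by the
  invariant plane of \<open>F (2 * i)\<close> and \<open>F (2 * i + 1)\<close>.\<close>

locale antisym_canonical =
  fixes N :: nat and A :: "nat \<Rightarrow> nat \<Rightarrow> real" and F :: "nat \<Rightarrow> nat \<Rightarrow> real" and l :: "nat \<Rightarrow> real"
  assumes antisym: "antisym_mat (2 * N) A"
    and orthonormal: "orthonormal (2 * N) (2 * N) F"
    and l_nonneg: "\<And>i. i < N \<Longrightarrow> 0 \<le> l i"
    and mv_even: "\<And>i p. i < N \<Longrightarrow> p < 2 * N \<Longrightarrow> mv (2 * N) A (F (2 * i)) p = l i * F (2 * i + 1) p"
    and mv_odd: "\<And>i p. i < N \<Longrightarrow> p < 2 * N \<Longrightarrow> mv (2 * N) A (F (2 * i + 1)) p = - l i * F (2 * i) p"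
begin

text \<open>In the basis \<open>F\<close> the matrix \<open>A\<close> swaps the two coordinates of
  each plane and multiplies them by \<open>l i\<close> up to sign, so Parseval compares both sides
  plane by plane. Applied to an approximate kernel vector, it bounds the smallest \<open>l i\<close>
  from above.\<close>

lemma ip_mv_ge:
  assumes "0 \<le> c" "\<And>i. i < N \<Longrightarrow> c \<le> l i"
  shows "c\<^sup>2 * ip (2 * N) u u \<le> ip (2 * N) (mv (2 * N) A u) (mv (2 * N) A u)"
proof -
  let ?n = "2 * N"
  have ev: "ip ?n (F (2 * i)) (mv ?n A u) = - l i * ip ?n (F (2 * i + 1)) u" if "i < N" for i
  proof -
    have "ip ?n (F (2 * i)) (mv ?n A u) = - ip ?n (mv ?n A (F (2 * i))) u"
      by (rule ip_mv_antisym[OF antisym])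
    also have "ip ?n (mv ?n A (F (2 * i))) u = ip ?n (\<lambda>p. l i * F (2 * i + 1) p) u"
      using mv_even[OF that] by (intro ip_cong) auto
    finally show ?thesis by (simp add: ip_linear)
  qed
  have od: "ip ?n (F (2 * i + 1)) (mv ?n A u) = l i * ip ?n (F (2 * i)) u" if "i < N" for i
  proof -
    have "ip ?n (F (2 * i + 1)) (mv ?n A u) = - ip ?n (mv ?n A (F (2 * i + 1))) u"
      by (rule ip_mv_antisym[OF antisym])
    also have "ip ?n (mv ?n A (F (2 * i + 1))) u = ip ?n (\<lambda>p. - l i * F (2 * i) p) u"
      using mv_odd[OF that] by (intro ip_cong) auto
    finally show ?thesis unfolding ip_linear by simp
  qed
  have "c\<^sup>2 * ip ?n u u = (\<Sum>i<N. c\<^sup>2 * ((ip ?n (F (2 * i)) u)\<^sup>2 + (ip ?n (F (2 * i + 1)) u)\<^sup>2))"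
    by (simp only: parseval[OF orthonormal] sum_pairs sum_distrib_left)
  also have "\<dots> \<le> (\<Sum>i<N. (l i)\<^sup>2 * ((ip ?n (F (2 * i)) u)\<^sup>2 + (ip ?n (F (2 * i + 1)) u)\<^sup>2))"
    using assms by (intro sum_mono mult_right_mono power_mono) auto
  also have "\<dots> = (\<Sum>i<N. (ip ?n (F (2 * i)) (mv ?n A u))\<^sup>2 + (ip ?n (F (2 * i + 1)) (mv ?n A u))\<^sup>2)"
  proof (intro sum.cong refl)
    fix i assume "i \<in> {..<N}"
    then show "(l i)\<^sup>2 * ((ip ?n (F (2 * i)) u)\<^sup>2 + (ip ?n (F (2 * i + 1)) u)\<^sup>2)
      = (ip ?n (F (2 * i)) (mv ?n A u))\<^sup>2 + (ip ?n (F (2 * i + 1)) (mv ?n A u))\<^sup>2"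
      by (simp only: ev od lessThan_iff) (simp add: power_mult_distrib algebra_simps)
  qed
  also have "\<dots> = ip ?n (mv ?n A u) (mv ?n A u)"
    by (simp only: parseval[OF orthonormal, of "mv ?n A u"] sum_pairs)
  finally show ?thesis .
qed

text \<open>A max-min argument: \<open>A\<close> stretches the span of the two planes by at most
  \<open>l j\<close>, while some unit vector there is mapped isometrically by \<open>chain\<close>,
  and \<open>V\<close> changes its image by at most \<open>eps\<close>.\<close>

lemma second_singular_value_ge:
  assumes ij: "i < N" "j < N" "i \<noteq> j" "l i \<le> l j"
    and A: "\<And>p q. p < 2 * N \<Longrightarrow> q < 2 * N \<Longrightarrow> A p q = chain (2 * N) p q + V p q"
    and V: "\<And>x. ip (2 * N) (mv (2 * N) V x) (mv (2 * N) V x) \<le> eps\<^sup>2 * ip (2 * N) x x"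
    and eps: "0 \<le> eps"
  shows "1 - eps \<le> l j"
proof -
  let ?n = "2 * N"
  define idx where "idx k = [2 * i, 2 * i + 1, 2 * j, 2 * j + 1] ! k" for k
  define b where "b k = F (idx k)" for k
  have idx: "idx 0 = 2 * i" "idx 1 = 2 * i + 1" "idx (Suc 0) = 2 * i + 1" "idx 2 = 2 * j" "idx 3 = 2 * j + 1"
    by (auto simp: idx_def)
  have less4: "k = 0 \<or> k = 1 \<or> k = 2 \<or> k = 3" if "k < 4" for k :: nat using that by auto
  have sum4: "sum h {..<4} = h 0 + h 1 + h 2 + h 3" for h :: "nat \<Rightarrow> real"
    by (simp add: eval_nat_numeral)
  have b: "orthonormal ?n 4 b"
    unfolding orthonormal_def
  proof (intro allI impI)
    fix k k' :: nat assume k: "k < 4" "k' < 4"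
    have "idx k < ?n \<and> idx k' < ?n \<and> (idx k = idx k' \<longleftrightarrow> k = k')"
      using less4[OF k(1)] less4[OF k(2)] ij(1-3) by (elim disjE; simp add: idx; presburger)
    then show "ip ?n (b k) (b k') = (if k = k' then 1 else 0)"
      using orthonormal unfolding orthonormal_def b_def by simp
  qed
  \<comment> \<open>The conditions that \<open>x\<close> vanish at both ends are two orthogonality
    relations for the coefficient vector in dimension four, so they have a normalised common
    solution.\<close>
  obtain a where a: "ip 4 a a = 1" "\<And>s. s < 2 \<Longrightarrow> ip 4 (\<lambda>k. if s = (0::nat) then b k 0 else b k (?n - 1)) a = 0"
    using exists_orthogonal_unit_vector[of 2 4 "\<lambda>s k. if s = (0::nat) then b k 0 else b k (?n - 1)"] by auto
  define x where "x = (\<lambda>p. \<Sum>k<4. a k * b k p)"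
  have x0: "x 0 = 0" using a(2)[of 0] by (simp add: x_def ip_def mult.commute)
  have x1: "x (?n - 1) = 0" using a(2)[of 1] by (simp add: x_def ip_def mult.commute)
  have asum: "(\<Sum>k<4. (a k)\<^sup>2) = 1" using a(1) by (simp add: ip_def power2_eq_square)
  have xx: "ip ?n x x = 1" unfolding x_def ip_orthonormal_comb[OF b] by (rule asum)
  \<comment> \<open>The coordinates of \<open>A x\<close> in the basis \<open>b\<close>: swapped
    within each plane and scaled by \<open>l i\<close> or \<open>l j\<close>.\<close>
  define a' where "a' k = [- l i * a 1, l i * a 0, - l j * a 3, l j * a 2] ! k" for k
  have Ax: "mv ?n A x p = (\<Sum>k<4. a' k * b k p)" if "p < ?n" for p
  proof -
    have "mv ?n A x p = (\<Sum>k<4. a k * mv ?n A (b k) p)"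
      unfolding x_def mv_sum mv_scale ..
    also have "\<dots> = (\<Sum>k<4. a' k * b k p)"
      unfolding sum4 b_def idx mv_even[OF ij(1) that] mv_odd[OF ij(1) that]
        mv_even[OF ij(2) that] mv_odd[OF ij(2) that]
      by (simp add: a'_def)
    finally show ?thesis .
  qed
  have "ip ?n (mv ?n A x) (mv ?n A x) = (\<Sum>k<4. (a' k)\<^sup>2)"
    unfolding ip_orthonormal_comb[OF b, symmetric] by (intro ip_cong Ax)
  also have "\<dots> = (l i)\<^sup>2 * ((a 0)\<^sup>2 + (a 1)\<^sup>2) + (l j)\<^sup>2 * ((a 2)\<^sup>2 + (a 3)\<^sup>2)"
    unfolding sum4 by (simp add: a'_def power_mult_distrib algebra_simps)
  also have "\<dots> \<le> (l j)\<^sup>2 * ((a 0)\<^sup>2 + (a 1)\<^sup>2) + (l j)\<^sup>2 * ((a 2)\<^sup>2 + (a 3)\<^sup>2)"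
    using ij(4) l_nonneg[OF ij(1)] by (intro add_right_mono mult_right_mono power_mono) auto
  also have "\<dots> = (l j)\<^sup>2 * (\<Sum>k<4. (a k)\<^sup>2)" unfolding sum4 by (simp add: algebra_simps)
  finally have "ip ?n (mv ?n A x) (mv ?n A x) \<le> (l j)\<^sup>2" unfolding asum by simp
  then have nA: "L2_set (mv ?n A x) {..<?n} \<le> l j"
    unfolding L2_set_eq_sqrt_ip using l_nonneg[OF ij(2)] by (simp add: real_le_lsqrt)
  have "ip ?n (mv ?n V x) (mv ?n V x) \<le> eps\<^sup>2" using V[of x] xx by simp
  then have nV: "L2_set (mv ?n V x) {..<?n} \<le> eps"
    unfolding L2_set_eq_sqrt_ip using eps by (simp add: real_le_lsqrt)
  have "mv ?n A x p = mv ?n (chain ?n) x p + mv ?n V x p" if "p < ?n" for p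
    using A[OF that] that by (simp add: mv_def sum.distrib algebra_simps)
  then have "L2_set (mv ?n (chain ?n) x) {..<?n} = L2_set (\<lambda>p. mv ?n A x p + - mv ?n V x p) {..<?n}"
    by (intro L2_set_cong refl) simp
  also have "\<dots> \<le> L2_set (mv ?n A x) {..<?n} + L2_set (\<lambda>p. - mv ?n V x p) {..<?n}"
    by (rule L2_set_triangle_ineq)
  also have "L2_set (\<lambda>p. - mv ?n V x p) {..<?n} = L2_set (mv ?n V x) {..<?n}"
    by (simp add: L2_set_def)
  also have "L2_set (mv ?n A x) {..<?n} + L2_set (mv ?n V x) {..<?n} \<le> l j + eps"
    using nA nV by simp
  also have "L2_set (mv ?n (chain ?n) x) {..<?n} = 1"
    unfolding L2_set_eq_sqrt_ip using x0 x1 xx by (simp add: ip_mv_chain_eq)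
  finally show ?thesis by simp
qed

end

text \<open>\<open>V (A V)\<^sup>k\<close> is a palindromic product of \<open>2 k + 1\<close>
  antisymmetric factors. Taking the adjoint reverses the word, which leaves it unchanged, and
  contributes an odd number of signs.\<close>

lemma ip_funpow_antisym:
  assumes A: "antisym_mat n A" and V: "antisym_mat n V"
  shows "ip n x (mv n V (((\<lambda>x. mv n A (mv n V x)) ^^ k) y))
     = - ip n (mv n V (((\<lambda>x. mv n A (mv n V x)) ^^ k) x)) y"
proof (induction k arbitrary: x)
  case 0
  then show ?case by (simp add: ip_mv_antisym[OF V, of x])
next
  case (Suc k)
  let ?T = "\<lambda>x. mv n A (mv n V x)"
  have "ip n x (mv n V ((?T ^^ Suc k) y)) = - ip n (mv n V x) (mv n A (mv n V ((?T ^^ k) y)))"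
    by (simp add: ip_mv_antisym[OF V, of x])
  also have "\<dots> = ip n (?T x) (mv n V ((?T ^^ k) y))"
    by (simp add: ip_mv_antisym[OF A, of "mv n V x"])
  also have "\<dots> = - ip n (mv n V ((?T ^^ k) (?T x))) y" by (rule Suc.IH)
  also have "(?T ^^ k) (?T x) = (?T ^^ Suc k) x" by (simp only: funpow_Suc_right comp_apply)
  finally show ?case .
qed

text \<open>The left edge mode: the truncated Neumann series for the kernel vector of \<open>chain + V\<close> starting
  from the kernel vector \<open>e\<^sub>0\<close> of \<open>chain\<close>. Since \<open>chain\<close> squares to \<open>-1\<close> away from both ends, the image of the
  partial sum telescopes to its last term as long as the ends are not hit; the left end is
  avoided by antisymmetry, the right end because of the finite range.\<close>

lemma edge_mode:
  assumes n: "even n" "0 < n"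
    and V: "antisym_mat n V"
    and range: "\<And>p q. p < n \<Longrightarrow> q < n \<Longrightarrow> q + r < p \<Longrightarrow> V p q = 0"
    and bound: "\<And>x. ip n (mv n V x) (mv n V x) \<le> eps\<^sup>2 * ip n x x"
    and m: "m * (r + 1) < n"
  shows "\<exists>u. 1 \<le> ip n u u \<and>
    ip n (mv n (\<lambda>p q. chain n p q + V p q) u) (mv n (\<lambda>p q. chain n p q + V p q) u) \<le> (eps ^ (m + 1))\<^sup>2"
proof -
  define T where "T = (\<lambda>x. mv n (chain n) (mv n V x))"
  define e where "e = (\<lambda>p :: nat. if p = 0 then 1 else 0 :: real)"
  define w where "w k = (T ^^ k) e" for k
  have w_Suc: "w (Suc k) = mv n (chain n) (mv n V (w k))" for k by (simp add: w_def T_def)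
  have Vsupp: "mv n V x p = 0" if x: "\<And>q. q < n \<Longrightarrow> s < q \<Longrightarrow> x q = 0" and p: "p < n" "s + r < p" for x p s
  proof -
    have "V p q * x q = 0" if "q < n" for q
      using range[of p q] x[of q] p that by (cases "s < q") auto
    then have "(\<Sum>q<n. V p q * x q) = 0" by (intro sum.neutral) auto
    then show ?thesis using p by (simp add: mv_def)
  qed
  \<comment> \<open>One round of \<open>V\<close> followed by \<open>chain\<close> moves the support
    to the right by at most \<open>r + 1\<close> sites.\<close>
  have supp: "w k p = 0" if "p < n" "k * (r + 1) < p" for k p
    using that
  proof (induction k arbitrary: p)
    case 0
    then show ?case by (simp add: w_def e_def)
  next
    case (Suc k)
    have "mv n V (w k) q = 0" if "q < n" "k * (r + 1) + r < q" for q
      using Suc.IH that by (intro Vsupp[of "k * (r + 1)"]) auto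
    then show ?case unfolding w_Suc using Suc.prems by (auto simp: mv_chain)
  qed
  \<comment> \<open>For \<open>k < m\<close> the vector \<open>V (w k)\<close> reaches at most site
    \<open>k * (r + 1) + r\<close>, and \<open>m * (r + 1) < n\<close> keeps this strictly left of
    \<open>n - 1\<close>.\<close>
  have right: "mv n V (w k) (n - 1) = 0" if "k < m" for k
  proof (rule Vsupp[OF supp])
    have "Suc k * (r + 1) \<le> m * (r + 1)" using that by (intro mult_right_mono) auto
    then show "k * (r + 1) + r < n - 1" using m by simp
  qed (use n in auto)
  have ip_e: "ip n e y = y 0" for y
  proof -
    have "ip n e y = (\<Sum>i<n. if i = 0 then y i else 0)"
      unfolding ip_def e_def by (intro sum.cong) auto
    then show ?thesis using n by simp
  qed
  \<comment> \<open>Site 0 of \<open>V (w k)\<close> is the diagonal matrix element at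
    \<open>e\<close> of an antisymmetric operator, hence equals its own negative.\<close>
  have left: "mv n V (w k) 0 = 0" for k
    using ip_funpow_antisym[OF antisym_mat_chain V, of e k e]
    by (simp add: ip_commute[of n _ e] ip_e w_def T_def)
  define B where "B = (\<lambda>p q. chain n p q + V p q)"
  have tele: "mv n B (\<lambda>p. \<Sum>k\<le>j. w k p) p = mv n V (w j) p" if "j \<le> m" "p < n" for j p
    using that(1)
  proof (induction j)
    case 0
    have "mv n (chain n) e p = 0" using that(2) by (auto simp: mv_chain e_def)
    then show ?case by (simp add: B_def mv_add_mat w_def)
  next
    case (Suc j)
    \<comment> \<open>Since both ends of \<open>V (w j)\<close> vanish, \<open>chain\<close> applied
      to the new term cancels the remainder \<open>V (w j)\<close> of the previous partial sum and
      only \<open>V (w (Suc j))\<close> survives.\<close>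
    have "mv n (chain n) (w (Suc j)) p = - mv n V (w j) p"
      unfolding w_Suc using mv_chain_chain[OF that(2) n(1)] left[of j] right[of j] Suc.prems by auto
    then show ?case using Suc by (simp add: mv_add B_def mv_add_mat)
  qed
  have norm: "ip n (w k) (w k) \<le> (eps ^ k)\<^sup>2" for k
  proof (induction k)
    case 0
    then show ?case by (simp add: w_def ip_e) (simp add: e_def)
  next
    case (Suc k)
    have "ip n (w (Suc k)) (w (Suc k)) \<le> ip n (mv n V (w k)) (mv n V (w k))"
      unfolding w_Suc by (rule ip_mv_chain_le[OF n(1)])
    also have "\<dots> \<le> eps\<^sup>2 * ip n (w k) (w k)" by (rule bound)
    also have "\<dots> \<le> eps\<^sup>2 * (eps ^ k)\<^sup>2" using Suc.IH by (intro mult_left_mono) auto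
    finally show ?case by (simp add: power_mult_distrib)
  qed
  define u where "u = (\<lambda>p. \<Sum>k\<le>m. w k p)"
  \<comment> \<open>Images under \<open>chain\<close> vanish at site 0, so only the starting vector
    contributes there. This keeps \<open>u\<close> from being small.\<close>
  have "w (Suc k) 0 = 0" for k unfolding w_Suc using n by (simp add: mv_chain)
  then have "w k 0 = (if k = 0 then 1 else 0)" for k
    by (cases k) (simp_all add: w_def[of 0] e_def)
  then have "u 0 = 1" by (simp add: u_def)
  then have "1 \<le> ip n u u"
    unfolding ip_def using n member_le_sum[of 0 "{..<n}" "\<lambda>i. u i * u i"] by simp
  moreover have "ip n (mv n B u) (mv n B u) = ip n (mv n V (w m)) (mv n V (w m))"
    unfolding u_def by (intro ip_cong tele) auto
  moreover have "\<dots> \<le> eps\<^sup>2 * (eps ^ m)\<^sup>2"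
    using bound[of "w m"] norm[of m] by (meson mult_left_mono order_trans zero_le_power2)
  ultimately show ?thesis unfolding B_def by (intro exI[of _ u]) (simp add: power_mult_distrib)
qed

section \<open>Translating the hypotheses on norm, strength and range into usable bounds\<close>

lemma vec_norm2_vec: "vec_norm2 (vec n x) = sqrt (ip n x x)"
  by (simp add: vec_norm2_def ip_def power2_eq_square)

lemma vec_norm2_mult_mat_vec:
  assumes "V \<in> carrier_mat n n"
  shows "vec_norm2 (V *\<^sub>v vec n x) = sqrt (ip n (mv n (\<lambda>p q. V $$ (p, q)) x) (mv n (\<lambda>p q. V $$ (p, q)) x))"
proof -
  have "V *\<^sub>v vec n x = vec n (mv n (\<lambda>p q. V $$ (p, q)) x)"
    using assms by (intro eq_vecI) (auto simp: mv_def scalar_prod_def row_def atLeast0LessThan intro!: sum.cong)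
  then show ?thesis by (simp only: vec_norm2_vec)
qed

lemma op_norm_bound:
  assumes V: "V \<in> carrier_mat n n" and le: "op_norm V \<le> eps"
  defines "W \<equiv> \<lambda>p q. V $$ (p, q)"
  shows "ip n (mv n W x) (mv n W x) \<le> eps\<^sup>2 * ip n x x"
proof -
  define S where "S = {vec_norm2 (V *\<^sub>v x) | x. dim_vec x = dim_col V \<and> vec_norm2 x \<le> 1}"
  \<comment> \<open>The supremum in \<open>op_norm\<close> controls its members only if the set is
    bounded above; the sum of the absolute values of all entries is a crude bound.\<close>
  have bdd: "bdd_above S"
  proof (rule bdd_aboveI)
    fix s assume "s \<in> S"
    then obtain v where v: "dim_vec v = n" "vec_norm2 v \<le> 1" "s = vec_norm2 (V *\<^sub>v v)"
      using V by (auto simp: S_def)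
    define y where "y = (\<lambda>i. v $ i)"
    have vy: "v = vec n y" using v(1) by (auto simp: y_def)
    have y1: "ip n y y \<le> 1" using v(2) by (simp add: vy vec_norm2_vec)
    have y2: "\<bar>y q\<bar> \<le> 1" if "q < n" for q
    proof -
      have "(y q)\<^sup>2 \<le> ip n y y" unfolding ip_def power2_eq_square
        using that by (intro member_le_sum) auto
      then show ?thesis using y1 by (simp add: abs_square_le_1[symmetric])
    qed
    have "s = sqrt (ip n (mv n W y) (mv n W y))" unfolding v(3) vy W_def by (rule vec_norm2_mult_mat_vec[OF V])
    also have "\<dots> = L2_set (mv n W y) {..<n}" by (simp add: L2_set_eq_sqrt_ip)
    also have "\<dots> \<le> (\<Sum>p<n. \<bar>mv n W y p\<bar>)" by (rule L2_set_le_sum_abs)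
    also have "\<dots> \<le> (\<Sum>p<n. \<Sum>q<n. \<bar>W p q\<bar>)"
    proof (intro sum_mono)
      fix p assume "p \<in> {..<n}"
      then have "\<bar>mv n W y p\<bar> = \<bar>\<Sum>q<n. W p q * y q\<bar>" by (simp add: mv_def)
      also have "\<dots> \<le> (\<Sum>q<n. \<bar>W p q * y q\<bar>)" by (rule sum_abs)
      also have "\<dots> \<le> (\<Sum>q<n. \<bar>W p q\<bar>)"
        using y2 by (intro sum_mono) (auto simp: abs_mult intro!: mult_left_le)
      finally show "\<bar>mv n W y p\<bar> \<le> (\<Sum>q<n. \<bar>W p q\<bar>)" .
    qed
    finally show "s \<le> (\<Sum>p<n. \<Sum>q<n. \<bar>W p q\<bar>)" .
  qed
  have unit: "ip n (mv n W y) (mv n W y) \<le> eps\<^sup>2" if "ip n y y = 1" for y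
  proof -
    have "vec_norm2 (V *\<^sub>v vec n y) \<in> S"
      unfolding S_def using V that by (auto simp: vec_norm2_vec intro!: exI[of _ "vec n y"])
    then have "vec_norm2 (V *\<^sub>v vec n y) \<le> eps"
      using cSup_upper[OF _ bdd] le unfolding op_norm_def S_def[symmetric] by fastforce
    then show ?thesis
      unfolding vec_norm2_mult_mat_vec[OF V] W_def[symmetric]
      by (simp add: sqrt_le_D)
  qed
  show ?thesis
  proof (cases "ip n x x = 0")
    case True
    then have "mv n W x = mv n W (\<lambda>i. 0 * x i)"
      using ip_eq_0D[OF True] by (intro mv_cong) auto
    then have "mv n W x = (\<lambda>i. 0)" unfolding mv_scale by simp
    then show ?thesis by (simp add: ip_def sum_nonneg)
  next
    case False
    then have pos: "ip n x x > 0" using ip_nonneg[of n x] by linarith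
    define a where "a = 1 / sqrt (ip n x x)"
    have a: "a * a * ip n x x = 1" using pos unfolding a_def by simp
    have "ip n (mv n W (\<lambda>i. a * x i)) (mv n W (\<lambda>i. a * x i)) \<le> eps\<^sup>2"
      using a by (intro unit) (simp add: ip_linear mult.assoc)
    then have "a * a * ip n (mv n W x) (mv n W x) \<le> eps\<^sup>2"
      by (simp add: mv_scale ip_linear mult.assoc)
    then have "a * a * ip n (mv n W x) (mv n W x) * ip n x x \<le> eps\<^sup>2 * ip n x x"
      using pos by (simp add: mult_right_mono)
    moreover have "a * a * ip n (mv n W x) (mv n W x) * ip n x x
        = (a * a * ip n x x) * ip n (mv n W x) (mv n W x)" by simp
    ultimately show ?thesis using a by simp
  qed
qed

text \<open>From \<open>r + 1 \<le> 2 * r\<close> one gets \<open>m + 1 \<ge> N / r\<close>, and a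
  base below 1 reverses the exponent inequality. The rest is
  \<open>eps\<^sup>2 \<le> 2 * eps / (1 + eps)\<close>. The case \<open>eps = 0\<close> is separate:
  both sides are then zero.\<close>

lemma power_le_powr_edge:
  fixes eps :: real
  assumes "1 \<le> r" "0 \<le> eps" "eps < 1" and m: "2 * N \<le> (m + 1) * (r + 1)"
  shows "eps ^ (m + 1) \<le> (2 * eps / (1 + eps)) powr (real N / (2 * real r))"
proof (cases "eps = 0")
  case False
  then have pos: "0 < eps" using assms by simp
  have "real (2 * N) \<le> real ((m + 1) * (r + 1))" using m by (rule of_nat_mono)
  also have "\<dots> = real (m + 1) * (real r + 1)" by (simp add: algebra_simps)
  also have "\<dots> \<le> real (m + 1) * (2 * real r)" using assms(1) by (intro mult_left_mono) auto
  finally have "real N / real r \<le> real (m + 1)" using assms(1) by (simp add: field_simps)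
  then have "eps powr real (m + 1) \<le> eps powr (real N / real r)"
    using pos assms(3) by (intro powr_mono') auto
  also have "\<dots> = (eps powr 2) powr (real N / (2 * real r))" by (simp add: powr_powr)
  also have "\<dots> = (eps\<^sup>2) powr (real N / (2 * real r))" using pos by simp
  also have "\<dots> \<le> (2 * eps / (1 + eps)) powr (real N / (2 * real r))"
  proof (rule powr_mono2)
    have "eps * (1 + eps) \<le> 1 * 2" using assms by (intro mult_mono) auto
    then have "eps * (eps * (1 + eps)) \<le> eps * 2" using pos by (intro mult_left_mono) auto
    then show "eps\<^sup>2 \<le> 2 * eps / (1 + eps)"
      using pos by (simp add: field_simps power2_eq_square)
  qed auto
  finally show ?thesis unfolding powr_realpow[OF pos] .
qed auto

section \<open>Majorana operators\<close>

text \<open>Quotient and remainder identify a flat index of a Kronecker product with a pair of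
  indices of its factors.\<close>

lemma sum_div_mod:
  fixes g :: "nat \<Rightarrow> nat \<Rightarrow> 'a :: comm_monoid_add"
  shows "(\<Sum>k<b * e. g (k div e) (k mod e)) = (\<Sum>x<b. \<Sum>y<e. g x y)"
proof (induction b)
  case (Suc b)
  have "(\<Sum>k<Suc b * e. g (k div e) (k mod e))
      = (\<Sum>k<b * e. g (k div e) (k mod e)) + (\<Sum>k\<in>{b * e..<b * e + e}. g (k div e) (k mod e))"
    using sum.atLeastLessThan_concat[of 0 "b * e" "b * e + e" "\<lambda>k. g (k div e) (k mod e)"]
    by (simp add: atLeast0LessThan add.commute)
  also have "(\<Sum>k\<in>{b * e..<b * e + e}. g (k div e) (k mod e)) = (\<Sum>y<e. g b y)"
    using sum.shift_bounds_nat_ivl[of "\<lambda>k. g (k div e) (k mod e)" 0 "b * e" e]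
    by (simp add: atLeast0LessThan add.commute)
  finally show ?case using Suc by simp
qed auto

lemma div_mod_less_mult:
  fixes i :: nat
  assumes "i < a * d"
  shows "i div d < a" "i mod d < d"
  using assms by (auto simp: less_mult_imp_div_less intro: mod_less_divisor) (cases d; simp)

lemma kron_carrier: "A \<in> carrier_mat a b \<Longrightarrow> B \<in> carrier_mat c d \<Longrightarrow> kron A B \<in> carrier_mat (a * c) (b * d)"
  unfolding kron_def by auto

lemma kron_index:
  assumes "A \<in> carrier_mat a b" "B \<in> carrier_mat c d" "i < a * c" "j < b * d"
  shows "kron A B $$ (i, j) = A $$ (i div c, j div d) * B $$ (i mod c, j mod d)"
  using assms unfolding kron_def by auto

lemma kron_mult:
  assumes A: "A \<in> carrier_mat a b" and B: "B \<in> carrier_mat d e"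
    and C: "C \<in> carrier_mat b c" and D: "D \<in> carrier_mat e f"
  shows "kron A B * kron C D = kron (A * C) (B * D)"
proof (rule eq_matI)
  have AC: "A * C \<in> carrier_mat a c" and BD: "B * D \<in> carrier_mat d f" using assms by auto
  fix i j assume "i < dim_row (kron (A * C) (B * D))" "j < dim_col (kron (A * C) (B * D))"
  then have ij: "i < a * d" "j < c * f" using kron_carrier[OF AC BD] by auto
  note i = div_mod_less_mult[OF ij(1)] and j = div_mod_less_mult[OF ij(2)]
  have "(kron A B * kron C D) $$ (i, j) = (\<Sum>k<b * e. kron A B $$ (i, k) * kron C D $$ (k, j))"
    using ij kron_carrier[OF A B] kron_carrier[OF C D]
    by (auto simp: scalar_prod_def atLeast0LessThan intro!: sum.cong)
  also have "\<dots> = (\<Sum>k<b * e. (A $$ (i div d, k div e) * B $$ (i mod d, k mod e)) *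
      (C $$ (k div e, j div f) * D $$ (k mod e, j mod f)))"
    using ij by (intro sum.cong refl) (simp add: kron_index[OF A B] kron_index[OF C D])
  also have "\<dots> = (\<Sum>x<b. \<Sum>y<e. (A $$ (i div d, x) * B $$ (i mod d, y)) *
      (C $$ (x, j div f) * D $$ (y, j mod f)))"
    by (rule sum_div_mod)
  also have "\<dots> = (\<Sum>x<b. A $$ (i div d, x) * C $$ (x, j div f)) * (\<Sum>y<e. B $$ (i mod d, y) * D $$ (y, j mod f))"
    unfolding sum_product by (simp add: mult_ac)
  also have "(\<Sum>x<b. A $$ (i div d, x) * C $$ (x, j div f)) = (A * C) $$ (i div d, j div f)"
    using i j A C by (auto simp: scalar_prod_def atLeast0LessThan intro!: sum.cong)
  also have "(\<Sum>y<e. B $$ (i mod d, y) * D $$ (y, j mod f)) = (B * D) $$ (i mod d, j mod f)"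
    using i j B D by (auto simp: scalar_prod_def atLeast0LessThan intro!: sum.cong)
  finally show "(kron A B * kron C D) $$ (i, j) = kron (A * C) (B * D) $$ (i, j)"
    by (simp only: kron_index[OF AC BD ij])
qed (use assms in \<open>auto simp: kron_def\<close>)

lemma kron_add_left:
  assumes "A \<in> carrier_mat a b" "A' \<in> carrier_mat a b" "B \<in> carrier_mat c d"
  shows "kron A B + kron A' B = kron (A + A') B"
  using assms div_mod_less_mult[of _ a c] div_mod_less_mult[of _ b d]
  by (intro eq_matI) (simp_all add: kron_def algebra_simps)

lemma kron_add_right:
  assumes "A \<in> carrier_mat a b" "B \<in> carrier_mat c d" "B' \<in> carrier_mat c d"
  shows "kron A B + kron A B' = kron A (B + B')"
  using assms div_mod_less_mult[of _ a c] div_mod_less_mult[of _ b d]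
  by (intro eq_matI) (simp_all add: kron_def algebra_simps)

lemma kron_smult_left: "kron (x \<cdot>\<^sub>m A) B = x \<cdot>\<^sub>m kron A B"
  by (intro eq_matI) (auto simp: kron_def div_mod_less_mult[of _ "dim_row A" "dim_row B"]
      div_mod_less_mult[of _ "dim_col A" "dim_col B"])

lemma kron_smult_right: "kron A (x \<cdot>\<^sub>m B) = x \<cdot>\<^sub>m kron A B"
  by (intro eq_matI) (auto simp: kron_def div_mod_less_mult[of _ "dim_row A" "dim_row B"]
      div_mod_less_mult[of _ "dim_col A" "dim_col B"])

lemma kron_one: "kron (1\<^sub>m a) (1\<^sub>m b) = 1\<^sub>m (a * b)"
proof (rule eq_matI)
  fix i j assume "i < dim_row (1\<^sub>m (a * b) :: complex mat)" "j < dim_col (1\<^sub>m (a * b) :: complex mat)"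
  then have ij: "i < a * b" "j < a * b" by auto
  have "i = j \<longleftrightarrow> i div b = j div b \<and> i mod b = j mod b"
    by (metis div_mult_mod_eq)
  then show "kron (1\<^sub>m a) (1\<^sub>m b) $$ (i, j) = 1\<^sub>m (a * b) $$ (i, j)"
    using ij div_mod_less_mult[OF ij(1)] div_mod_less_mult[OF ij(2)] by (auto simp: kron_def)
qed (auto simp: kron_def)

section \<open>Jordan-Wigner strings and the Majorana relations\<close>

lemma pauli_carrier [simp]:
  "pauli_X \<in> carrier_mat 2 2" "pauli_Y \<in> carrier_mat 2 2" "pauli_Z \<in> carrier_mat 2 2"
  by (auto simp: pauli_X_def pauli_Y_def pauli_Z_def mat_of_rows_list_def)

text \<open>All relations, including the vanishing ones, are multiples of the identity, so that a
  single tensor rule parametrised by the scalar can consume them.\<close>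

lemma pauli_anticommute:
  "pauli_X * pauli_X + pauli_X * pauli_X = 2 \<cdot>\<^sub>m 1\<^sub>m 2"
  "pauli_Y * pauli_Y + pauli_Y * pauli_Y = 2 \<cdot>\<^sub>m 1\<^sub>m 2"
  "pauli_X * pauli_Y + pauli_Y * pauli_X = 0 \<cdot>\<^sub>m 1\<^sub>m 2"
  "pauli_Y * pauli_X + pauli_X * pauli_Y = 0 \<cdot>\<^sub>m 1\<^sub>m 2"
  "pauli_X * pauli_Z + pauli_Z * pauli_X = 0 \<cdot>\<^sub>m 1\<^sub>m 2"
  "pauli_Z * pauli_X + pauli_X * pauli_Z = 0 \<cdot>\<^sub>m 1\<^sub>m 2"
  "pauli_Y * pauli_Z + pauli_Z * pauli_Y = 0 \<cdot>\<^sub>m 1\<^sub>m 2"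
  "pauli_Z * pauli_Y + pauli_Y * pauli_Z = 0 \<cdot>\<^sub>m 1\<^sub>m 2"
  by (rule eq_matI; auto simp: pauli_X_def pauli_Y_def pauli_Z_def mat_of_rows_list_def scalar_prod_def
      less_2_cases_iff)+

lemma pauli_Z_square: "pauli_Z * pauli_Z = 1\<^sub>m 2"
  by (rule eq_matI) (auto simp: pauli_Z_def mat_of_rows_list_def scalar_prod_def less_2_cases_iff)

lemma tensor_list_identity: "tensor_list (replicate N (1\<^sub>m 2)) = 1\<^sub>m (2 ^ N)"
  by (induction N) (auto simp: tensor_list_def kron_one)

lemma jw_string_1: "jw_string (Suc N) 1 P = kron P (1\<^sub>m (2 ^ N))"
  unfolding jw_string_def using tensor_list_identity[of N] by (simp add: tensor_list_def)

lemma jw_string_Suc: "1 \<le> j \<Longrightarrow> jw_string (Suc N) (Suc j) P = kron pauli_Z (jw_string N j P)"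
  unfolding jw_string_def by (cases j) (auto simp: tensor_list_def)

lemma majorana_1: "majorana (Suc N) 1 = kron pauli_X (1\<^sub>m (2 ^ N))"
  by (simp add: majorana_def jw_string_1[unfolded One_nat_def])

lemma majorana_2: "majorana (Suc N) 2 = kron pauli_Y (1\<^sub>m (2 ^ N))"
  by (simp add: majorana_def jw_string_1[unfolded One_nat_def])

lemma majorana_add2: "1 \<le> p \<Longrightarrow> majorana (Suc N) (p + 2) = kron pauli_Z (majorana N p)"
proof (cases "odd p")
  case True
  have "1 \<le> (p + 1) div 2" "(p + 2 + 1) div 2 = Suc ((p + 1) div 2)" if "1 \<le> p" using that by auto
  then show "majorana (Suc N) (p + 2) = kron pauli_Z (majorana N p)" if "1 \<le> p"
    using True that by (simp only: majorana_def jw_string_Suc) simp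
next
  case False
  have "1 \<le> p div 2" "(p + 2) div 2 = Suc (p div 2)" if "1 \<le> p"
    using that False by (auto elim!: evenE)
  then show "majorana (Suc N) (p + 2) = kron pauli_Z (majorana N p)" if "1 \<le> p"
    using False that by (simp only: majorana_def jw_string_Suc) simp
qed

lemma majorana_cases:
  assumes "p < 2 * Suc N"
  obtains "p = 0" | "p = 1" | p' where "p = p' + 2" "p' < 2 * N"
proof -
  consider "p = 0" | "p = 1" | "2 \<le> p" by linarith
  then show ?thesis
  proof cases
    case 3
    then show ?thesis using assms that(3)[of "p - 2"] by simp
  qed (use that in auto)
qed

text \<open>The recursion that splits off the first qubit, with \<open>Suc p\<close> as index so
  that \<open>p\<close> runs from 0 like the matrix indices.\<close>

lemma majorana_Suc:
  "majorana (Suc N) (Suc 0) = kron pauli_X (1\<^sub>m (2 ^ N))"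
  "majorana (Suc N) (Suc 1) = kron pauli_Y (1\<^sub>m (2 ^ N))"
  "majorana (Suc N) (Suc (p + 2)) = kron pauli_Z (majorana N (Suc p))"
  using majorana_1[of N] majorana_2[of N] majorana_add2[of "Suc p" N]
  by (simp_all add: numeral_2_eq_2)

lemma majorana_carrier: "p < 2 * N \<Longrightarrow> majorana N (Suc p) \<in> carrier_mat (2 ^ N) (2 ^ N)"
proof (induction N arbitrary: p)
  case (Suc N)
  note kc = kron_carrier[of _ 2 2 _ "2 ^ N" "2 ^ N"]
  from Suc.prems show ?case
  proof (cases p rule: majorana_cases)
    case 1
    then show ?thesis using kc[of pauli_X "1\<^sub>m (2 ^ N)"] by (simp add: majorana_Suc)
  next
    case 2
    then show ?thesis using kc[of pauli_Y "1\<^sub>m (2 ^ N)"] by (simp only: majorana_Suc) simp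
  next
    case (3 p')
    then show ?thesis using kc[of pauli_Z, OF _ Suc.IH[of p']] by (simp only: majorana_Suc) simp
  qed
qed simp

text \<open>Induction by splitting off the first qubit. If one of the operators sits on that qubit,
  the Pauli relation there decides; otherwise the two factors \<open>pauli_Z\<close> cancel and the
  induction hypothesis acts on the remaining qubits.\<close>

lemma majorana_anticommute:
  assumes "p < 2 * N" "q < 2 * N"
  shows "majorana N (Suc p) * majorana N (Suc q) + majorana N (Suc q) * majorana N (Suc p)
    = (if p = q then 2 else 0) \<cdot>\<^sub>m 1\<^sub>m (2 ^ N)"
  using assms
proof (induction N arbitrary: p q)
  case (Suc N)
  let ?I = "1\<^sub>m (2 ^ N) :: complex mat"
  \<comment> \<open>Covers every pair in which at least one operator sits on the first qubit: one of
    the right-hand factors is then an identity matrix, so these factors commute.\<close>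
  have local: "kron P B * kron Q C + kron Q C * kron P B = x \<cdot>\<^sub>m kron (1\<^sub>m 2) (B * C)"
    if "P \<in> carrier_mat 2 2" "Q \<in> carrier_mat 2 2" "B \<in> carrier_mat (2 ^ N) (2 ^ N)" "C \<in> carrier_mat (2 ^ N) (2 ^ N)"
      "P * Q + Q * P = x \<cdot>\<^sub>m 1\<^sub>m 2" "B * C = C * B" for P Q B C x
  proof -
    have "kron P B * kron Q C + kron Q C * kron P B = kron (P * Q) (B * C) + kron (Q * P) (B * C)"
      using that(1-4) by (simp add: kron_mult[of _ 2 2 _ "2 ^ N" "2 ^ N" _ 2 _ "2 ^ N"] that(6))
    also have "\<dots> = kron (P * Q + Q * P) (B * C)"
      using that(1-4) by (intro kron_add_left[of _ 2 2 _ _ "2 ^ N" "2 ^ N"]) auto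
    finally show ?thesis by (simp only: that(5) kron_smult_left)
  qed
  have zero: "0 \<cdot>\<^sub>m kron (1\<^sub>m 2) B = 0 \<cdot>\<^sub>m 1\<^sub>m (2 ^ Suc N)" if "B \<in> carrier_mat (2 ^ N) (2 ^ N)" for B
    using that by (intro eq_matI) (auto simp: kron_def)
  have one: "x \<cdot>\<^sub>m kron (1\<^sub>m 2) (?I * ?I) = x \<cdot>\<^sub>m 1\<^sub>m (2 ^ Suc N)" for x
    by (simp add: kron_one)
  show ?case
    using Suc.prems(1)
  proof (cases p rule: majorana_cases)
    case p: 1
    show ?thesis using Suc.prems(2)
    proof (cases q rule: majorana_cases)
      case 1
      with p show ?thesis by (simp only: majorana_Suc) (simp add: local[of _ _ _ _ 2] pauli_anticommute kron_one)
    next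
      case 2
      with p show ?thesis by (simp only: majorana_Suc) (simp add: local[of _ _ _ _ 0] pauli_anticommute kron_one)
    next
      case (3 q')
      with p majorana_carrier[of q' N] zero show ?thesis
        by (simp only: majorana_Suc) (simp add: local[of _ _ _ _ 0] pauli_anticommute)
    qed
  next
    case p: 2
    show ?thesis using Suc.prems(2)
    proof (cases q rule: majorana_cases)
      case 1
      with p show ?thesis by (simp only: majorana_Suc) (simp add: local[of _ _ _ _ 0] pauli_anticommute kron_one)
    next
      case 2
      with p show ?thesis by (simp only: majorana_Suc) (simp add: local[of _ _ _ _ 2] pauli_anticommute kron_one)
    next
      case (3 q')
      with p majorana_carrier[of q' N] zero show ?thesis
        by (simp only: majorana_Suc) (simp add: local[of _ _ _ _ 0] pauli_anticommute)
    qed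
  next
    case p: (3 p')
    show ?thesis using Suc.prems(2)
    proof (cases q rule: majorana_cases)
      case 1
      with p majorana_carrier[of p' N] zero show ?thesis
        by (simp only: majorana_Suc) (simp add: local[of _ _ _ _ 0] pauli_anticommute)
    next
      case 2
      with p majorana_carrier[of p' N] zero show ?thesis
        by (simp only: majorana_Suc) (simp add: local[of _ _ _ _ 0] pauli_anticommute)
    next
      case q: (3 q')
      let ?M = "majorana N (Suc p')" and ?M' = "majorana N (Suc q')"
      have M: "?M \<in> carrier_mat (2 ^ N) (2 ^ N)" "?M' \<in> carrier_mat (2 ^ N) (2 ^ N)"
        using p q majorana_carrier by auto
      have "kron pauli_Z ?M * kron pauli_Z ?M' + kron pauli_Z ?M' * kron pauli_Z ?M
         = kron (1\<^sub>m 2) (?M * ?M') + kron (1\<^sub>m 2) (?M' * ?M)"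
        using M by (simp add: kron_mult[of _ 2 2 _ "2 ^ N" "2 ^ N" _ 2 _ "2 ^ N"] pauli_Z_square)
      also have "\<dots> = kron (1\<^sub>m 2) (?M * ?M' + ?M' * ?M)"
        using M by (intro kron_add_right[of _ 2 2 _ "2 ^ N" "2 ^ N"]) auto
      also have "\<dots> = (if p = q then 2 else 0) \<cdot>\<^sub>m 1\<^sub>m (2 ^ Suc N)"
        using Suc.IH[of p' q'] p q by (simp add: kron_smult_right kron_one)
      finally show ?thesis unfolding p(1) q(1) majorana_Suc .
    qed
  qed
qed simp

section \<open>Spectra from commuting mode parities\<close>

lemma mult_mat_vec_index:
  "A \<in> carrier_mat d d \<Longrightarrow> v \<in> carrier_vec d \<Longrightarrow> a < d \<Longrightarrow> (A *\<^sub>v v) $ a = (\<Sum>b<d. A $$ (a, b) * v $ b)"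
  by (auto simp: scalar_prod_def row_def atLeast0LessThan intro!: sum.cong)

lemma mult_mat_index:
  "A \<in> carrier_mat d d \<Longrightarrow> B \<in> carrier_mat d d \<Longrightarrow> a < d \<Longrightarrow> b < d \<Longrightarrow>
   (A * B) $$ (a, b) = (\<Sum>k<d. A $$ (a, k) * B $$ (k, b))"
  by (auto simp: scalar_prod_def row_def col_def atLeast0LessThan intro!: sum.cong)

text \<open>An invertible matrix of eigenvectors makes \<open>H\<close> similar to a diagonal
  matrix. Similarity preserves the characteristic polynomial, so multiplicities come out
  right.\<close>

lemma proots_char_poly_eigenbasis:
  fixes H P :: "complex mat"
  assumes H: "H \<in> carrier_mat d d" and P: "P \<in> carrier_mat d d" and det: "det P \<noteq> 0"
    and eig: "\<And>a t. a < d \<Longrightarrow> t < d \<Longrightarrow> (\<Sum>b<d. H $$ (a, b) * P $$ (b, t)) = mu t * P $$ (a, t)"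
  shows "proots (char_poly H) = image_mset mu (mset_set {..<d})"
proof -
  define E where "E = mat d d (\<lambda>(i, j). if i = j then mu i else 0)"
  have E: "E \<in> carrier_mat d d" by (simp add: E_def)
  obtain Q where Q: "Q \<in> carrier_mat d d" "Q * P = 1\<^sub>m d" "P * Q = 1\<^sub>m d"
    using det_non_zero_imp_unit[OF P det, of "()"] unfolding Units_def ring_mat_def by auto
  have HP: "H * P = P * E"
  proof (rule eq_matI)
    fix a t assume "a < dim_row (P * E)" "t < dim_col (P * E)"
    then have at: "a < d" "t < d" using P E by auto
    have "(P * E) $$ (a, t) = (\<Sum>k<d. P $$ (a, k) * (if k = t then mu k else 0))"
      unfolding mult_mat_index[OF P E at] using at by (intro sum.cong) (auto simp: E_def)
    also have "\<dots> = mu t * P $$ (a, t)" using at by (simp add: if_distrib cong: if_cong)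
    finally show "(H * P) $$ (a, t) = (P * E) $$ (a, t)"
      using eig[OF at] by (simp add: mult_mat_index[OF H P at])
  qed (use H P E in auto)
  have "H = H * (P * Q)" using H Q by simp
  also have "\<dots> = P * E * Q" using assoc_mult_mat[OF H P Q(1)] HP by simp
  finally have "similar_mat H E"
    using H P E Q by (intro similar_matI[of _ _ P Q d]) auto
  then have "char_poly H = char_poly E" by (rule char_poly_similar)
  also have "\<dots> = (\<Prod>a\<leftarrow>diag_mat E. [:- a, 1:])"
    by (rule char_poly_upper_triangular[OF E]) (auto simp: E_def upper_triangular_def)
  also have "diag_mat E = map mu [0..<d]" by (auto simp: diag_mat_def E_def)
  also have "(\<Prod>a\<leftarrow>map mu [0..<d]. [:- a, 1:]) = (\<Prod>t<d. [:- mu t, 1:])"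
    by (simp add: prod.list_conv_set_nth atLeast0LessThan)
  finally have "proots (char_poly H) = (\<Sum>t<d. {#mu t#})"
    by (simp add: proots_prod)
  also have "\<dots> = image_mset mu (mset_set {..<d})" by (induction d) (auto simp: lessThan_Suc)
  finally show ?thesis .
qed

text \<open>The bits of \<open>t < 2 ^ N\<close> enumerate the sign patterns, so the number of a
  pattern doubles as the column index of its eigenvector.\<close>

definition sgn_bit :: "nat \<Rightarrow> nat \<Rightarrow> complex" where
  "sgn_bit t k = (if bit t k then 1 else - 1)"

lemma bits_determine:
  fixes s t N :: nat
  assumes "s < 2 ^ N" "t < 2 ^ N" "\<And>k. k < N \<Longrightarrow> bit s k = bit t k"
  shows "s = t"
proof -
  have "take_bit N s = take_bit N t" using assms(3) by (intro bit_eqI) (auto simp: bit_take_bit_iff)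
  then show ?thesis using assms(1,2) by (simp add: take_bit_nat_eq_self)
qed

text \<open>The setting after diagonalisation: the commuting involutions \<open>D k\<close> are the mode parities, and the
  involution \<open>f k\<close> flips the sign of \<open>D k\<close> alone.\<close>

locale mode_parities =
  fixes N d :: nat and D f :: "nat \<Rightarrow> complex mat"
  assumes D: "\<And>k. k < N \<Longrightarrow> D k \<in> carrier_mat d d"
    and f: "\<And>k. k < N \<Longrightarrow> f k \<in> carrier_mat d d"
    and DD: "\<And>k. k < N \<Longrightarrow> D k * D k = 1\<^sub>m d"
    and ff: "\<And>k. k < N \<Longrightarrow> f k * f k = 1\<^sub>m d"
    and D_comm: "\<And>j k. j < N \<Longrightarrow> k < N \<Longrightarrow> j \<noteq> k \<Longrightarrow> D j * D k = D k * D j"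
    and Df_comm: "\<And>j k. j < N \<Longrightarrow> k < N \<Longrightarrow> j \<noteq> k \<Longrightarrow> D j * f k = f k * D j"
    and Df_anti: "\<And>k. k < N \<Longrightarrow> D k * f k = - (f k * D k)"
    and d_pos: "0 < d"
begin

text \<open>The signs are fixed one after another: either the projection to the wanted eigenspace of
  \<open>D K\<close> is nonzero, or the vector has the opposite sign and \<open>f K\<close> flips
  it, leaving the earlier signs intact.\<close>

lemma exists_joint_eigenvector:
  assumes s: "\<And>k. s k = 1 \<or> s k = - 1" and "K \<le> N"
  shows "\<exists>v\<in>carrier_vec d. v \<noteq> 0\<^sub>v d \<and> (\<forall>k<K. D k *\<^sub>v v = s k \<cdot>\<^sub>v v)"
  using \<open>K \<le> N\<close>
proof (induction K)
  case 0
  have "unit_vec d 0 \<noteq> (0\<^sub>v d :: complex vec)" using d_pos by (simp add: unit_vec_nonzero)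
  then show ?case by (intro bexI[of _ "unit_vec d 0"]) auto
next
  case (Suc K)
  then have K: "K < N" by simp
  obtain v where v: "v \<in> carrier_vec d" "v \<noteq> 0\<^sub>v d" "\<And>k. k < K \<Longrightarrow> D k *\<^sub>v v = s k \<cdot>\<^sub>v v"
    using Suc by auto
  have ss: "s k * s k = 1" for k using s[of k] by auto
  note DK = D[OF K] and fK = f[OF K]
  \<comment> \<open>Twice the projection of \<open>v\<close> to the eigenspace of \<open>D K\<close>
    for \<open>s K\<close>.\<close>
  define w where "w = v + s K \<cdot>\<^sub>v (D K *\<^sub>v v)"
  show ?case
  proof (cases "w = 0\<^sub>v d")
    case False
    have DDv: "D K *\<^sub>v (D K *\<^sub>v v) = v" using DK v DD[OF K] by (simp flip: assoc_mult_mat_vec)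
    have "D K *\<^sub>v w = D K *\<^sub>v v + s K \<cdot>\<^sub>v v"
      unfolding w_def using DK v(1) DDv by (simp add: mult_add_distrib_mat_vec[of _ d d] mult_mat_vec[of _ d d])
    also have "\<dots> = s K \<cdot>\<^sub>v w" unfolding w_def using DK v(1) ss[of K]
      by (intro eq_vecI) (auto simp: algebra_simps simp flip: mult.assoc)
    finally have "D K *\<^sub>v w = s K \<cdot>\<^sub>v w" .
    moreover have "D k *\<^sub>v w = s k \<cdot>\<^sub>v w" if "k < K" for k
    proof -
      have k: "k < N" using that K by simp
      have "D k *\<^sub>v (D K *\<^sub>v v) = D K *\<^sub>v (D k *\<^sub>v v)"
        using D[OF k] DK v(1) D_comm[OF k K] that by (simp flip: assoc_mult_mat_vec)
      also have "\<dots> = s k \<cdot>\<^sub>v (D K *\<^sub>v v)" using v DK that by (simp add: mult_mat_vec[of _ d d])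
      finally have *: "D k *\<^sub>v (D K *\<^sub>v v) = s k \<cdot>\<^sub>v (D K *\<^sub>v v)" .
      have "D k *\<^sub>v w = D k *\<^sub>v v + s K \<cdot>\<^sub>v (D k *\<^sub>v (D K *\<^sub>v v))"
        unfolding w_def using DK D[OF k] v(1)
        by (simp add: mult_add_distrib_mat_vec[of _ d d] mult_mat_vec[of _ d d])
      also have "\<dots> = s k \<cdot>\<^sub>v w" unfolding * v(3)[OF that] w_def using DK v(1)
        by (intro eq_vecI) (auto simp: algebra_simps)
      finally show ?thesis .
    qed
    ultimately show ?thesis using False v(1) DK
      by (intro bexI[of _ w]) (auto simp: less_Suc_eq w_def)
  next
    case True
    have DKv: "D K *\<^sub>v v = (- s K) \<cdot>\<^sub>v v"
    proof (rule eq_vecI)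
      fix a assume "a < dim_vec ((- s K) \<cdot>\<^sub>v v)"
      then have a: "a < d" using v(1) by simp
      have "w $ a = v $ a + s K * (D K *\<^sub>v v) $ a" using a v(1) DK by (simp add: w_def)
      then have "s K * (v $ a + s K * (D K *\<^sub>v v) $ a) = 0" using True a by simp
      then have "s K * v $ a + (s K * s K) * (D K *\<^sub>v v) $ a = 0" by (simp add: algebra_simps)
      then show "(D K *\<^sub>v v) $ a = ((- s K) \<cdot>\<^sub>v v) $ a"
        using a v(1) by (simp add: ss add_eq_0_iff2 add.commute)
    qed (use v DK in auto)
    \<comment> \<open>\<open>u\<close> is nonzero because \<open>f K\<close> is an involution, and
      it gets the sign \<open>s K\<close> because \<open>f K\<close> anticommutes with
      \<open>D K\<close>.\<close>
    define u where "u = f K *\<^sub>v v"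
    have u: "u \<in> carrier_vec d" using v(1) fK by (simp add: u_def)
    have "f K *\<^sub>v u = v" unfolding u_def using fK v ff[OF K] by (simp flip: assoc_mult_mat_vec)
    then have "u \<noteq> 0\<^sub>v d" using v(2) fK by auto
    moreover have "D K *\<^sub>v u = s K \<cdot>\<^sub>v u"
    proof -
      have "D K *\<^sub>v u = (D K * f K) *\<^sub>v v" unfolding u_def using DK fK v(1) by simp
      also have "\<dots> = - (f K *\<^sub>v (D K *\<^sub>v v))" unfolding Df_anti[OF K] using DK fK v(1)
        by (simp add: uminus_mult_mat_vec)
      also have "\<dots> = s K \<cdot>\<^sub>v u" unfolding DKv u_def using fK v(1)
        by (auto simp: mult_mat_vec[of _ d d])
      finally show ?thesis .
    qed
    moreover have "D k *\<^sub>v u = s k \<cdot>\<^sub>v u" if "k < K" for k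
    proof -
      have k: "k < N" using that K by simp
      have "D k *\<^sub>v u = f K *\<^sub>v (D k *\<^sub>v v)"
        unfolding u_def using D[OF k] fK v(1) Df_comm[OF k K] that by (simp flip: assoc_mult_mat_vec)
      then show ?thesis unfolding v(3)[OF that] u_def using fK v(1) by (simp add: mult_mat_vec[of _ d d])
    qed
    ultimately show ?thesis using u by (intro bexI[of _ u]) (auto simp: less_Suc_eq)
  qed
qed

text \<open>Joint eigenvectors with different sign patterns are linearly independent. There are
  \<open>2 ^ N\<close> patterns, which is the dimension, so one vector per pattern forms an
  eigenbasis of \<open>H\<close>.\<close>

lemma proots_char_poly_parities:
  assumes d: "d = 2 ^ N" and H: "H \<in> carrier_mat d d"
    and HD: "\<And>a b. a < d \<Longrightarrow> b < d \<Longrightarrow> H $$ (a, b) = (\<Sum>k<N. c k * D k $$ (a, b))"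
  shows "proots (char_poly H) = image_mset (\<lambda>t. \<Sum>k<N. c k * sgn_bit t k) (mset_set {..<2 ^ N})"
proof -
  have "\<forall>t. \<exists>v\<in>carrier_vec d. v \<noteq> 0\<^sub>v d \<and> (\<forall>k<N. D k *\<^sub>v v = sgn_bit t k \<cdot>\<^sub>v v)"
    by (intro allI exists_joint_eigenvector) (auto simp: sgn_bit_def)
  then obtain v where v: "\<And>t. v t \<in> carrier_vec d" "\<And>t. v t \<noteq> 0\<^sub>v d"
     "\<And>t k. k < N \<Longrightarrow> D k *\<^sub>v v t = sgn_bit t k \<cdot>\<^sub>v v t" by metis
  have Dv: "(\<Sum>b<d. D k $$ (a, b) * v t $ b) = sgn_bit t k * v t $ a" if "k < N" "a < d" for k t a
  proof -
    have "(\<Sum>b<d. D k $$ (a, b) * v t $ b) = (D k *\<^sub>v v t) $ a"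
      using mult_mat_vec_index[OF D[OF that(1)] v(1) that(2)] by simp
    also have "\<dots> = sgn_bit t k * v t $ a" using v(1)[of t] that by (simp add: v(3))
    finally show ?thesis .
  qed
  define P where "P = mat d d (\<lambda>(a, t). v t $ a)"
  have P: "P \<in> carrier_mat d d" by (simp add: P_def)
  have "det P \<noteq> 0"
  proof
    assume "det P = 0"
    then obtain x where x: "x \<in> carrier_vec d" "x \<noteq> 0\<^sub>v d" "P *\<^sub>v x = 0\<^sub>v d"
      using det_0_iff_vec_prod_zero_field[OF P] by auto
    have Px: "(\<Sum>t<d. x $ t * v t $ a) = 0" if "a < d" for a
    proof -
      have "(P *\<^sub>v x) $ a = (\<Sum>t<d. x $ t * v t $ a)"
        unfolding mult_mat_vec_index[OF P x(1) that] using that by (intro sum.cong) (auto simp: P_def)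
      then show ?thesis using x(3) that by simp
    qed
    obtain s where s: "s < d" "x $ s \<noteq> 0"
      using x(1,2) by (metis carrier_vecD eq_vecI index_zero_vec(1,2))
    \<comment> \<open>The indices that agree with \<open>s\<close> in the first \<open>K\<close>
      bits. Projecting a linear relation to one more sign at a time shrinks its index set from
      \<open>S K\<close> to \<open>S (Suc K)\<close>.\<close>
    define S where "S K = {t. t < d \<and> (\<forall>k<K. bit t k = bit s k)}" for K
    have fin: "finite (S K)" for K by (rule finite_subset[of _ "{..<d}"]) (auto simp: S_def)
    have zero: "(\<Sum>t\<in>S K. x $ t * v t $ a) = 0" if "K \<le> N" "a < d" for K a
      using that
    proof (induction K arbitrary: a)
      case 0
      have "S 0 = {..<d}" by (auto simp: S_def)
      then show ?case using Px[OF 0(2)] by simp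
    next
      case (Suc K)
      then have K: "K < N" by simp
      have "0 = (\<Sum>b<d. D K $$ (a, b) * (\<Sum>t\<in>S K. x $ t * v t $ b))"
        using Suc.IH K by simp
      also have "\<dots> = (\<Sum>b<d. \<Sum>t\<in>S K. x $ t * (D K $$ (a, b) * v t $ b))"
        by (simp add: sum_distrib_left mult_ac)
      also have "\<dots> = (\<Sum>t\<in>S K. \<Sum>b<d. x $ t * (D K $$ (a, b) * v t $ b))" by (rule sum.swap)
      also have "\<dots> = (\<Sum>t\<in>S K. x $ t * (sgn_bit t K * v t $ a))"
        using Suc.prems by (simp only: sum_distrib_left[symmetric] Dv[OF K])
      finally have *: "(\<Sum>t\<in>S K. x $ t * (sgn_bit t K * v t $ a)) = 0" by simp
      have "2 * (\<Sum>t\<in>S (Suc K). x $ t * v t $ a) = (\<Sum>t\<in>S (Suc K). 2 * (x $ t * v t $ a))"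
        by (rule sum_distrib_left)
      \<comment> \<open>The factor is 2 if \<open>s\<close> and \<open>t\<close> agree in bit
        \<open>K\<close> and 0 otherwise.\<close>
      also have "\<dots> = (\<Sum>t\<in>S K. (1 + sgn_bit s K * sgn_bit t K) * (x $ t * v t $ a))"
        by (rule sum.mono_neutral_cong_left[OF fin])
          (auto simp: S_def sgn_bit_def less_Suc_eq)
      also have "\<dots> = (\<Sum>t\<in>S K. x $ t * v t $ a) + sgn_bit s K * (\<Sum>t\<in>S K. x $ t * (sgn_bit t K * v t $ a))"
        by (simp add: sum_distrib_left sum.distrib algebra_simps)
      also have "\<dots> = 0" using * Suc.IH[of a] Suc.prems by simp
      finally show ?case by simp
    qed
    \<comment> \<open>After \<open>N\<close> projections only the term of \<open>s\<close> is left,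
      with nonzero coefficient, which contradicts \<open>v s\<close> being nonzero.\<close>
    have "S N = {s}"
      using s(1) d bits_determine[of _ N s] by (auto simp: S_def)
    then have "v s $ a = 0" if "a < d" for a using zero[OF order_refl that] s(2) by simp
    then have "v s = 0\<^sub>v d" using v(1)[of s] by (intro eq_vecI) auto
    then show False using v(2) by blast
  qed
  then have "proots (char_poly H) = image_mset (\<lambda>t. \<Sum>k<N. c k * sgn_bit t k) (mset_set {..<d})"
  proof (rule proots_char_poly_eigenbasis[OF H P])
    fix a t assume at: "a < d" "t < d"
    have "(\<Sum>b<d. H $$ (a, b) * P $$ (b, t)) = (\<Sum>b<d. \<Sum>k<N. c k * (D k $$ (a, b) * v t $ b))"
      using at by (intro sum.cong) (auto simp: HD P_def sum_distrib_right mult.assoc)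
    also have "\<dots> = (\<Sum>k<N. \<Sum>b<d. c k * (D k $$ (a, b) * v t $ b))" by (rule sum.swap)
    also have "\<dots> = (\<Sum>k<N. c k * (sgn_bit t k * v t $ a))"
      using Dv at by (intro sum.cong refl) (simp flip: sum_distrib_left)
    also have "\<dots> = (\<Sum>k<N. c k * sgn_bit t k) * P $$ (a, t)"
      using at by (simp add: P_def sum_distrib_right mult.assoc)
    finally show "(\<Sum>b<d. H $$ (a, b) * P $$ (b, t)) = (\<Sum>k<N. c k * sgn_bit t k) * P $$ (a, t)" .
  qed
  then show ?thesis by (simp only: d)
qed

end

section \<open>Diagonalisation of the Hamiltonian\<close>

text \<open>A rotated Majorana operator: orthonormal coefficient vectors yield operators that again
  satisfy the Majorana relations.\<close>

definition clifford :: "nat \<Rightarrow> (nat \<Rightarrow> real) \<Rightarrow> complex mat" where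
  "clifford N f = mat (2 ^ N) (2 ^ N)
     (\<lambda>(a, b). \<Sum>p<2 * N. complex_of_real (f p) * majorana N (Suc p) $$ (a, b))"

lemma clifford_carrier [simp]: "clifford N f \<in> carrier_mat (2 ^ N) (2 ^ N)"
  by (simp add: clifford_def)

lemma clifford_mult_index:
  assumes ab: "a < 2 ^ N" "b < 2 ^ N"
  shows "(clifford N f * clifford N g) $$ (a, b)
     = (\<Sum>p<2 * N. \<Sum>q<2 * N. complex_of_real (f p * g q) * (majorana N (Suc p) * majorana N (Suc q)) $$ (a, b))"
proof -
  let ?M = "\<lambda>p. majorana N (Suc p)"
  have "(clifford N f * clifford N g) $$ (a, b) = (\<Sum>k<2 ^ N. clifford N f $$ (a, k) * clifford N g $$ (k, b))"
    by (rule mult_mat_index) (use ab in auto)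
  also have "\<dots> = (\<Sum>k<2 ^ N. \<Sum>p<2 * N. \<Sum>q<2 * N. complex_of_real (f p * g q) * (?M p $$ (a, k) * ?M q $$ (k, b)))"
    using ab by (intro sum.cong refl) (simp add: clifford_def sum_product mult_ac)
  also have "\<dots> = (\<Sum>p<2 * N. \<Sum>k<2 ^ N. \<Sum>q<2 * N. complex_of_real (f p * g q) * (?M p $$ (a, k) * ?M q $$ (k, b)))"
    by (rule sum.swap)
  also have "\<dots> = (\<Sum>p<2 * N. \<Sum>q<2 * N. \<Sum>k<2 ^ N. complex_of_real (f p * g q) * (?M p $$ (a, k) * ?M q $$ (k, b)))"
    by (intro sum.cong refl sum.swap)
  also have "\<dots> = (\<Sum>p<2 * N. \<Sum>q<2 * N. complex_of_real (f p * g q) * (?M p * ?M q) $$ (a, b))"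
    using ab by (intro sum.cong refl)
      (simp add: mult_mat_index[OF majorana_carrier majorana_carrier] flip: sum_distrib_left)
  finally show ?thesis .
qed

lemma clifford_anticommute:
  "clifford N f * clifford N g + clifford N g * clifford N f
    = complex_of_real (2 * ip (2 * N) f g) \<cdot>\<^sub>m 1\<^sub>m (2 ^ N)"
proof (rule eq_matI)
  fix a b assume "a < dim_row (complex_of_real (2 * ip (2 * N) f g) \<cdot>\<^sub>m 1\<^sub>m (2 ^ N))"
    "b < dim_col (complex_of_real (2 * ip (2 * N) f g) \<cdot>\<^sub>m 1\<^sub>m (2 ^ N))"
  then have ab: "a < 2 ^ N" "b < 2 ^ N" by auto
  let ?M = "\<lambda>p. majorana N (Suc p)"
  let ?n = "2 * N" and ?I = "1\<^sub>m (2 ^ N) $$ (a, b) :: complex"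
  have anti: "(?M p * ?M q) $$ (a, b) + (?M q * ?M p) $$ (a, b) = (if p = q then 2 else 0) * ?I"
    if "p < ?n" "q < ?n" for p q
  proof -
    have "(?M p * ?M q + ?M q * ?M p) $$ (a, b) = ((if p = q then 2 else 0) \<cdot>\<^sub>m 1\<^sub>m (2 ^ N)) $$ (a, b)"
      by (simp only: majorana_anticommute[OF that])
    then show ?thesis using ab majorana_carrier[OF that(1)] majorana_carrier[OF that(2)] by auto
  qed
  have "(clifford N g * clifford N f) $$ (a, b)
     = (\<Sum>p<?n. \<Sum>q<?n. complex_of_real (f p * g q) * (?M q * ?M p) $$ (a, b))"
    unfolding clifford_mult_index[OF ab] by (subst sum.swap) (simp add: mult_ac)
  then have "(clifford N f * clifford N g) $$ (a, b) + (clifford N g * clifford N f) $$ (a, b)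
     = (\<Sum>p<?n. \<Sum>q<?n. complex_of_real (f p * g q) * ((?M p * ?M q) $$ (a, b) + (?M q * ?M p) $$ (a, b)))"
    unfolding clifford_mult_index[OF ab] by (simp add: sum.distrib distrib_left)
  also have "\<dots> = (\<Sum>p<?n. \<Sum>q<?n. if p = q then complex_of_real (f p * g q) * (2 * ?I) else 0)"
    by (intro sum.cong refl) (simp add: anti)
  also have "\<dots> = complex_of_real (2 * ip ?n f g) * ?I"
    by (simp add: ip_def sum_distrib_left sum_distrib_right mult_ac)
  finally show "(clifford N f * clifford N g + clifford N g * clifford N f) $$ (a, b)
     = (complex_of_real (2 * ip ?n f g) \<cdot>\<^sub>m 1\<^sub>m (2 ^ N)) $$ (a, b)"
    using ab by (simp add: clifford_def)
qed (auto simp: clifford_def)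

lemma clifford_square:
  assumes "ip (2 * N) f f = 1"
  shows "clifford N f * clifford N f = 1\<^sub>m (2 ^ N)"
proof (rule eq_matI)
  fix a b assume "a < dim_row (1\<^sub>m (2 ^ N) :: complex mat)" "b < dim_col (1\<^sub>m (2 ^ N) :: complex mat)"
  then have ab: "a < 2 ^ N" "b < 2 ^ N" by auto
  have "(clifford N f * clifford N f + clifford N f * clifford N f) $$ (a, b) = (2 \<cdot>\<^sub>m 1\<^sub>m (2 ^ N)) $$ (a, b)"
    unfolding clifford_anticommute assms by simp
  moreover have "(clifford N f * clifford N f + clifford N f * clifford N f) $$ (a, b)
     = 2 * (clifford N f * clifford N f) $$ (a, b)"
    using ab by (simp add: clifford_def)
  ultimately show "(clifford N f * clifford N f) $$ (a, b) = 1\<^sub>m (2 ^ N) $$ (a, b)"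
    using ab by simp
qed (auto simp: clifford_def)

lemma clifford_orthogonal:
  assumes "ip (2 * N) f g = 0"
  shows "clifford N f * clifford N g = - (clifford N g * clifford N f)"
proof (rule eq_matI)
  fix a b assume "a < dim_row (- (clifford N g * clifford N f))" "b < dim_col (- (clifford N g * clifford N f))"
  then have ab: "a < 2 ^ N" "b < 2 ^ N" by (auto simp: clifford_def)
  have "(clifford N f * clifford N g + clifford N g * clifford N f) $$ (a, b) = (0 \<cdot>\<^sub>m 1\<^sub>m (2 ^ N)) $$ (a, b)"
    unfolding clifford_anticommute assms by simp
  moreover have "(clifford N f * clifford N g + clifford N g * clifford N f) $$ (a, b)
     = (clifford N f * clifford N g) $$ (a, b) + (clifford N g * clifford N f) $$ (a, b)"
    using ab by (simp add: clifford_def)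
  moreover have "(- (clifford N g * clifford N f)) $$ (a, b) = - (clifford N g * clifford N f) $$ (a, b)"
    using ab by (simp add: clifford_def)
  ultimately show "(clifford N f * clifford N g) $$ (a, b) = (- (clifford N g * clifford N f)) $$ (a, b)"
    using ab by (simp add: add_eq_0_iff2)
qed (auto simp: clifford_def)

lemma anticommute_pair_commute:
  fixes A B C :: "'a :: comm_ring_1 mat"
  assumes A: "A \<in> carrier_mat d d" and B: "B \<in> carrier_mat d d" and C: "C \<in> carrier_mat d d"
    and AB: "A * B = - (B * A)" and AC: "A * C = - (C * A)"
  shows "A * (B * C) = (B * C) * A"
proof -
  have "A * (B * C) = (A * B) * C" using assoc_mult_mat[OF A B C] by simp
  also have "\<dots> = - (B * A * C)" unfolding AB using A B C by simp
  also have "B * A * C = B * (A * C)" using assoc_mult_mat[OF B A C] .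
  also have "B * (A * C) = - (B * (C * A))" unfolding AC using A B C by simp
  also have "B * (C * A) = (B * C) * A" using assoc_mult_mat[OF B C A] by simp
  finally show ?thesis by simp
qed

text \<open>The pair products square to \<open>-1\<close>, whence the factor \<open>\<i>\<close>.
  Products of distinct pairs commute since the signs cancel in twos, while the even member of a pair
  anticommutes with its own product and commutes with all others.\<close>

lemma mode_parities_clifford:
  assumes F: "orthonormal (2 * N) (2 * N) F"
  shows "mode_parities N (2 ^ N) (\<lambda>k. \<i> \<cdot>\<^sub>m (clifford N (F (2 * k + 1)) * clifford N (F (2 * k))))
     (\<lambda>k. clifford N (F (2 * k)))"
proof -
  let ?d = "2 ^ N :: nat"
  define C where "C i = clifford N (F i)" for i
  have C: "C i \<in> carrier_mat ?d ?d" for i by (simp add: C_def)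
  have sq: "C i * C i = 1\<^sub>m ?d" if "i < 2 * N" for i
    unfolding C_def using F that by (intro clifford_square) (simp add: orthonormal_def)
  have anti: "C i * C j = - (C j * C i)" if "i < 2 * N" "j < 2 * N" "i \<noteq> j" for i j
    unfolding C_def using F that by (intro clifford_orthogonal) (simp add: orthonormal_def)
  define G where "G k = C (2 * k + 1) * C (2 * k)" for k
  have G: "G k \<in> carrier_mat ?d ?d" for k unfolding G_def by (rule mult_carrier_mat[OF C C])
  have CG: "C i * G k = G k * C i" if "i < 2 * N" "k < N" "i \<noteq> 2 * k" "i \<noteq> 2 * k + 1" for i k
    unfolding G_def using that by (intro anticommute_pair_commute[OF C C C] anti) auto
  have GG_comm: "G j * G k = G k * G j" if "j < N" "k < N" "j \<noteq> k" for j k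
  proof -
    have c1: "C (2 * j) * G k = G k * C (2 * j)" using that by (intro CG; presburger)
    have c2: "C (2 * j + 1) * G k = G k * C (2 * j + 1)" using that by (intro CG; presburger)
    have "G j * G k = C (2 * j + 1) * (C (2 * j) * G k)"
      unfolding G_def[of j] by (rule assoc_mult_mat[OF C C G])
    also have "\<dots> = (C (2 * j + 1) * G k) * C (2 * j)"
      unfolding c1 by (rule assoc_mult_mat[OF C G C, symmetric])
    also have "\<dots> = G k * G j" unfolding c2 G_def[of j] by (rule assoc_mult_mat[OF G C C])
    finally show ?thesis .
  qed
  have fG: "C (2 * k) * G k = - (G k * C (2 * k))" if "k < N" for k
  proof -
    have "C (2 * k) * G k = (C (2 * k) * C (2 * k + 1)) * C (2 * k)"
      unfolding G_def by (rule assoc_mult_mat[OF C C C, symmetric])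
    also have "C (2 * k) * C (2 * k + 1) = - G k" unfolding G_def using that by (intro anti) auto
    finally show ?thesis using C[of "2 * k"] G[of k] by simp
  qed
  have GG: "G k * G k = - 1\<^sub>m ?d" if "k < N" for k
  proof -
    have "G k * G k = C (2 * k + 1) * (C (2 * k) * G k)"
      by (subst (1) G_def) (rule assoc_mult_mat[OF C C G])
    also have "\<dots> = - (C (2 * k + 1) * (G k * C (2 * k)))"
      unfolding fG[OF that] using C[of "2 * k"] C[of "2 * k + 1"] G[of k] by simp
    also have "G k * C (2 * k) = C (2 * k + 1) * (C (2 * k) * C (2 * k))"
      unfolding G_def by (rule assoc_mult_mat[OF C C C])
    also have "\<dots> = C (2 * k + 1)" using that C[of "2 * k + 1"] by (simp add: sq)
    finally show ?thesis using that by (simp add: sq)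
  qed
  have "mode_parities N ?d (\<lambda>k. \<i> \<cdot>\<^sub>m G k) (\<lambda>k. C (2 * k))"
  proof
    fix k assume k: "k < N"
    show "\<i> \<cdot>\<^sub>m G k \<in> carrier_mat ?d ?d" using G by simp
    show "C (2 * k) \<in> carrier_mat ?d ?d" by (rule C)
    have "\<i> \<cdot>\<^sub>m G k * (\<i> \<cdot>\<^sub>m G k) = \<i> \<cdot>\<^sub>m (\<i> \<cdot>\<^sub>m (G k * G k))" using G[of k] by auto
    then show "\<i> \<cdot>\<^sub>m G k * (\<i> \<cdot>\<^sub>m G k) = 1\<^sub>m ?d"
      unfolding GG[OF k] by (auto intro!: eq_matI)
    show "C (2 * k) * C (2 * k) = 1\<^sub>m ?d" using k by (intro sq) simp
    show "\<i> \<cdot>\<^sub>m G k * C (2 * k) = - (C (2 * k) * (\<i> \<cdot>\<^sub>m G k))"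
    proof -
      have "C (2 * k) * (\<i> \<cdot>\<^sub>m G k) = \<i> \<cdot>\<^sub>m (C (2 * k) * G k)" using C[of "2 * k"] G[of k] by auto
      moreover have "\<i> \<cdot>\<^sub>m G k * C (2 * k) = \<i> \<cdot>\<^sub>m (G k * C (2 * k))" using C[of "2 * k"] G[of k] by auto
      ultimately show ?thesis unfolding fG[OF k] using C[of "2 * k"] G[of k] by (auto intro!: eq_matI)
    qed
  next
    fix j k assume jk: "j < N" "k < N" "j \<noteq> k"
    have "\<i> \<cdot>\<^sub>m G j * (\<i> \<cdot>\<^sub>m G k) = \<i> \<cdot>\<^sub>m (\<i> \<cdot>\<^sub>m (G j * G k))" for j k using G[of j] G[of k] by auto
    then show "\<i> \<cdot>\<^sub>m G j * (\<i> \<cdot>\<^sub>m G k) = \<i> \<cdot>\<^sub>m G k * (\<i> \<cdot>\<^sub>m G j)"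
      by (simp add: GG_comm[OF jk])
    have "C (2 * k) * G j = G j * C (2 * k)" using jk by (intro CG; presburger)
    then show "\<i> \<cdot>\<^sub>m G j * C (2 * k) = C (2 * k) * (\<i> \<cdot>\<^sub>m G j)"
      by (simp only: mult_smult_assoc_mat[OF G C] mult_smult_distrib[OF C G])
  qed simp
  then show ?thesis unfolding C_def G_def .
qed

section \<open>The Hamiltonian as a single quadratic form\<close>

lemma chain_eq_sum:
  assumes "p < 2 * N" "q < 2 * N"
  shows "chain (2 * N) p q = (\<Sum>j\<in>{1..N - 1}. (if p = 2 * j - 1 \<and> q = 2 * j then 1 else 0)
     - (if p = 2 * j \<and> q = 2 * j - 1 then 1 else 0))"
proof -
  \<comment> \<open>At most one bond matches a given pair of sites, namely
    \<open>j = q div 2\<close>; below it is \<open>p div 2\<close> for the reversed order.\<close>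
  have "(\<Sum>j\<in>{1..N - 1}. if p = 2 * j - 1 \<and> q = 2 * j then 1 else 0 :: real)
      = (\<Sum>j\<in>{1..N - 1}. if j = q div 2 then if even q \<and> q = p + 1 then 1 else 0 else 0)"
    by (intro sum.cong refl) auto
  also have "\<dots> = (if even q \<and> q = p + 1 then 1 else 0)" using assms by auto
  finally have 1: "(\<Sum>j\<in>{1..N - 1}. if p = 2 * j - 1 \<and> q = 2 * j then 1 else 0 :: real)
      = (if even q \<and> q = p + 1 then 1 else 0)" .
  have "(\<Sum>j\<in>{1..N - 1}. if p = 2 * j \<and> q = 2 * j - 1 then 1 else 0 :: real)
      = (\<Sum>j\<in>{1..N - 1}. if j = p div 2 then if even p \<and> p = q + 1 then 1 else 0 else 0)"
    by (intro sum.cong refl) auto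
  also have "\<dots> = (if even p \<and> p = q + 1 then 1 else 0)" using assms by auto
  finally have 2: "(\<Sum>j\<in>{1..N - 1}. if p = 2 * j \<and> q = 2 * j - 1 then 1 else 0 :: real)
      = (if even p \<and> p = q + 1 then 1 else 0)" .
  show ?thesis unfolding sum_subtractf 1 2 using assms by (auto simp: chain_def)
qed

text \<open>Both orders of a bond contribute equally; the resulting factor 2 reconciles the
  prefactor \<open>\<i> / 4\<close> with the \<open>\<i> / 2\<close> of \<open>H0\<close>.\<close>

lemma sum_chain_antisym:
  fixes X :: "nat \<Rightarrow> nat \<Rightarrow> complex"
  assumes X: "\<And>p q. p < 2 * N \<Longrightarrow> q < 2 * N \<Longrightarrow> p \<noteq> q \<Longrightarrow> X q p = - X p q"
  shows "(\<Sum>p<2 * N. \<Sum>q<2 * N. complex_of_real (chain (2 * N) p q) * X p q) = 2 * (\<Sum>j\<in>{1..N - 1}. X (2 * j - 1) (2 * j))"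
proof -
  let ?n = "2 * N"
  have pick: "(\<Sum>p<?n. \<Sum>q<?n. if p = s \<and> q = t then X p q else 0) = X s t" if "s < ?n" "t < ?n" for s t
  proof -
    have "(\<Sum>p<?n. \<Sum>q<?n. if p = s \<and> q = t then X p q else 0) = (\<Sum>p<?n. if p = s then \<Sum>q<?n. if q = t then X p q else 0 else 0)"
      by (intro sum.cong refl) auto
    then show ?thesis using that by simp
  qed
  have "(\<Sum>p<?n. \<Sum>q<?n. complex_of_real (chain ?n p q) * X p q)
      = (\<Sum>p<?n. \<Sum>q<?n. \<Sum>j\<in>{1..N - 1}. (if p = 2 * j - 1 \<and> q = 2 * j then X p q else 0)
          - (if p = 2 * j \<and> q = 2 * j - 1 then X p q else 0))"
    by (intro sum.cong refl) (auto simp: chain_eq_sum sum_distrib_right intro!: sum.cong)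
  also have "\<dots> = (\<Sum>p<?n. \<Sum>j\<in>{1..N - 1}. \<Sum>q<?n. (if p = 2 * j - 1 \<and> q = 2 * j then X p q else 0)
          - (if p = 2 * j \<and> q = 2 * j - 1 then X p q else 0))"
    by (intro sum.cong refl sum.swap)
  also have "\<dots> = (\<Sum>j\<in>{1..N - 1}. \<Sum>p<?n. \<Sum>q<?n. (if p = 2 * j - 1 \<and> q = 2 * j then X p q else 0)
          - (if p = 2 * j \<and> q = 2 * j - 1 then X p q else 0))"
    by (rule sum.swap)
  also have "\<dots> = (\<Sum>j\<in>{1..N - 1}. 2 * X (2 * j - 1) (2 * j))"
  proof (intro sum.cong refl)
    fix j assume "j \<in> {1..N - 1}"
    then have j: "2 * j - 1 < ?n" "2 * j < ?n" "2 * j - 1 \<noteq> 2 * j" by auto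
    show "(\<Sum>p<?n. \<Sum>q<?n. (if p = 2 * j - 1 \<and> q = 2 * j then X p q else 0)
          - (if p = 2 * j \<and> q = 2 * j - 1 then X p q else 0)) = 2 * X (2 * j - 1) (2 * j)"
      unfolding sum_subtractf pick[OF j(1,2)] pick[OF j(2,1)] X[OF j] by simp
  qed
  also have "\<dots> = 2 * (\<Sum>j\<in>{1..N - 1}. X (2 * j - 1) (2 * j))" by (rule sum_distrib_left[symmetric])
  finally show ?thesis .
qed

lemma hamiltonian_index:
  assumes ab: "a < 2 ^ N" "b < 2 ^ N"
  shows "(H0 N + Vhat N V) $$ (a, b) = (\<i> / 4) * (\<Sum>p<2 * N. \<Sum>q<2 * N.
     complex_of_real (chain (2 * N) p q + V $$ (p, q)) * (majorana N (Suc p) * majorana N (Suc q)) $$ (a, b))"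
proof -
  define X where "X p q = (majorana N (Suc p) * majorana N (Suc q)) $$ (a, b)" for p q
  have anti: "X q p = - X p q" if "p < 2 * N" "q < 2 * N" "p \<noteq> q" for p q
  proof -
    have "(majorana N (Suc p) * majorana N (Suc q) + majorana N (Suc q) * majorana N (Suc p)) $$ (a, b)
      = (0 \<cdot>\<^sub>m 1\<^sub>m (2 ^ N)) $$ (a, b)" using that by (simp only: majorana_anticommute) simp
    then have "X p q + X q p = 0"
      using ab majorana_carrier[OF that(1)] majorana_carrier[OF that(2)] by (simp add: X_def)
    then show ?thesis by (simp add: eq_neg_iff_add_eq_0 add.commute)
  qed
  have "(\<Sum>j\<in>{1..N - 1}. (majorana N (2 * j) * majorana N (2 * j + 1)) $$ (a, b))
     = (\<Sum>j\<in>{1..N - 1}. X (2 * j - 1) (2 * j))"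
    by (intro sum.cong refl) (simp add: X_def)
  then have "H0 N $$ (a, b) = (\<i> / 4) * (2 * (\<Sum>j\<in>{1..N - 1}. X (2 * j - 1) (2 * j)))"
    using ab by (simp add: H0_def)
  also have "\<dots> = (\<i> / 4) * (\<Sum>p<2 * N. \<Sum>q<2 * N. complex_of_real (chain (2 * N) p q) * X p q)"
  proof -
    have "(\<Sum>p<2 * N. \<Sum>q<2 * N. complex_of_real (chain (2 * N) p q) * X p q)
       = 2 * (\<Sum>j\<in>{1..N - 1}. X (2 * j - 1) (2 * j))"
      by (rule sum_chain_antisym) (rule anti)
    then show ?thesis by simp
  qed
  finally have h: "H0 N $$ (a, b) = \<dots>" .
  have "Vhat N V $$ (a, b) = (\<i> / 4) * (\<Sum>p<2 * N. \<Sum>q<2 * N. complex_of_real (V $$ (p, q)) * X p q)"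
    using ab by (simp add: Vhat_def X_def sum.atLeast1_atMost_eq)
  moreover have "(H0 N + Vhat N V) $$ (a, b) = H0 N $$ (a, b) + Vhat N V $$ (a, b)"
    using ab by (simp add: Vhat_def H0_def)
  ultimately show ?thesis using h
    by (simp add: X_def sum.distrib distrib_left distrib_right)
qed

section \<open>Energy levels and the two lowest gaps\<close>

definition mode_energy :: "nat \<Rightarrow> (nat \<Rightarrow> real) \<Rightarrow> nat \<Rightarrow> real" where
  "mode_energy N l t = (\<Sum>k<N. l k / 2 * (if bit t k then 1 else - 1))"

text \<open>Inserting the canonical form decouples the modes: each block gives
  \<open>\<i> / 4\<close> times \<open>l k\<close> times a commutator of two anticommuting
  operators, which equals \<open>l k / 2\<close> times the parity of mode \<open>k\<close>.\<close>

lemma sorted_eigenvalues_hamiltonian: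
  assumes F: "orthonormal (2 * N) (2 * N) F"
    and A: "\<And>p q. p < 2 * N \<Longrightarrow> q < 2 * N \<Longrightarrow> chain (2 * N) p q + V $$ (p, q)
       = (\<Sum>i<N. l i * (F (2 * i + 1) p * F (2 * i) q - F (2 * i) p * F (2 * i + 1) q))"
  shows "sorted_eigenvalues (H0 N + Vhat N V)
     = sorted_list_of_multiset (image_mset (mode_energy N l) (mset_set {..<2 ^ N}))"
proof -
  let ?n = "2 * N"
  let ?D = "\<lambda>k. \<i> \<cdot>\<^sub>m (clifford N (F (2 * k + 1)) * clifford N (F (2 * k)))"
  interpret mode_parities N "2 ^ N" ?D "\<lambda>k. clifford N (F (2 * k))"
    by (rule mode_parities_clifford[OF F])
  have "proots (char_poly (H0 N + Vhat N V))
     = image_mset (\<lambda>t. \<Sum>k<N. complex_of_real (l k / 2) * sgn_bit t k) (mset_set {..<2 ^ N})"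
  proof (rule proots_char_poly_parities)
    fix a b :: nat assume ab: "a < 2 ^ N" "b < 2 ^ N"
    define X where "X p q = (majorana N (Suc p) * majorana N (Suc q)) $$ (a, b)" for p q
    let ?C = "\<lambda>i j. (clifford N (F i) * clifford N (F j)) $$ (a, b)"
    have expand: "complex_of_real (chain ?n p q + V $$ (p, q)) * X p q = (\<Sum>k<N. complex_of_real (l k) *
       (complex_of_real (F (2 * k + 1) p * F (2 * k) q) * X p q - complex_of_real (F (2 * k) p * F (2 * k + 1) q) * X p q))"
      if "p < ?n" "q < ?n" for p q
      unfolding A[OF that] of_real_sum sum_distrib_right by (intro sum.cong refl) (simp add: algebra_simps)
    have "(H0 N + Vhat N V) $$ (a, b) = (\<i> / 4) * (\<Sum>p<?n. \<Sum>q<?n. (\<Sum>k<N. complex_of_real (l k) *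
       (complex_of_real (F (2 * k + 1) p * F (2 * k) q) * X p q - complex_of_real (F (2 * k) p * F (2 * k + 1) q) * X p q)))"
      unfolding hamiltonian_index[OF ab] X_def[symmetric]
      by (intro arg_cong2[where f = "(*)"] sum.cong refl expand) auto
    also have "(\<Sum>p<?n. \<Sum>q<?n. (\<Sum>k<N. complex_of_real (l k) *
       (complex_of_real (F (2 * k + 1) p * F (2 * k) q) * X p q - complex_of_real (F (2 * k) p * F (2 * k + 1) q) * X p q)))
      = (\<Sum>p<?n. \<Sum>k<N. \<Sum>q<?n. complex_of_real (l k) *
       (complex_of_real (F (2 * k + 1) p * F (2 * k) q) * X p q - complex_of_real (F (2 * k) p * F (2 * k + 1) q) * X p q))"
      by (intro sum.cong refl sum.swap)
    also have "\<dots> = (\<Sum>k<N. \<Sum>p<?n. \<Sum>q<?n. complex_of_real (l k) *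
       (complex_of_real (F (2 * k + 1) p * F (2 * k) q) * X p q - complex_of_real (F (2 * k) p * F (2 * k + 1) q) * X p q))"
      by (rule sum.swap)
    also have "\<dots> = (\<Sum>k<N. complex_of_real (l k) * (?C (2 * k + 1) (2 * k) - ?C (2 * k) (2 * k + 1)))"
      by (simp only: clifford_mult_index[OF ab] X_def sum_distrib_left[symmetric] sum_subtractf)
    also have "\<dots> = (\<Sum>k<N. complex_of_real (l k) * (2 * ?C (2 * k + 1) (2 * k)))"
    proof (intro sum.cong refl)
      fix k assume "k \<in> {..<N}"
      then have "clifford N (F (2 * k)) * clifford N (F (2 * k + 1)) = - (clifford N (F (2 * k + 1)) * clifford N (F (2 * k)))"
        using F by (intro clifford_orthogonal) (simp add: orthonormal_def)
      then have "?C (2 * k) (2 * k + 1) = - ?C (2 * k + 1) (2 * k)"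
        using ab by (simp add: clifford_def)
      then show "complex_of_real (l k) * (?C (2 * k + 1) (2 * k) - ?C (2 * k) (2 * k + 1))
         = complex_of_real (l k) * (2 * ?C (2 * k + 1) (2 * k))" by simp
    qed
    also have "(\<i> / 4) * \<dots> = (\<Sum>k<N. complex_of_real (l k / 2) * (\<i> * ?C (2 * k + 1) (2 * k)))"
      by (simp add: sum_distrib_left mult_ac)
    also have "\<dots> = (\<Sum>k<N. complex_of_real (l k / 2) * ?D k $$ (a, b))"
      using ab by (intro sum.cong refl) (simp add: clifford_def)
    finally show "(H0 N + Vhat N V) $$ (a, b) = \<dots>" .
  qed (auto simp: H0_def Vhat_def)
  moreover have "Re (\<Sum>k<N. complex_of_real (l k / 2) * sgn_bit t k) = mode_energy N l t" for t
    by (auto simp: mode_energy_def sgn_bit_def intro!: sum.cong)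
  ultimately show ?thesis unfolding sorted_eigenvalues_def
    by (simp add: image_mset.compositionality comp_def)
qed

text \<open>Energies counted from the pattern without set bits, which is a ground state when all
  \<open>l k\<close> are nonnegative: setting bit \<open>k\<close> changes its term from
  \<open>- l k / 2\<close> to \<open>l k / 2\<close>.\<close>

lemma mode_energy_eq: "mode_energy N l t = mode_energy N l 0 + (\<Sum>k<N. if bit t k then l k else 0)"
  unfolding mode_energy_def sum.distrib[symmetric] by (intro sum.cong) auto

lemma mode_energy_power:
  assumes "i < N"
  shows "mode_energy N l (2 ^ i) = mode_energy N l 0 + l i"
proof -
  have "(\<Sum>k<N. if bit (2 ^ i :: nat) k then l k else 0) = (\<Sum>k<N. if k = i then l k else 0)"
    by (intro sum.cong) (auto simp: bit_exp_iff)
  then show ?thesis using assms by (subst mode_energy_eq) simp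
qed

text \<open>The patterns \<open>0\<close>, \<open>2 ^ i\<close> and \<open>2 ^ j\<close> are lowest:
  every other one, including the one with both bits \<open>i\<close> and \<open>j\<close>, excites
  some mode different from \<open>i\<close> and so costs at least \<open>l j\<close>.\<close>

lemma three_lowest_energies:
  assumes ij: "i < N" "j < N" "i \<noteq> j"
    and l: "\<And>k. k < N \<Longrightarrow> 0 \<le> l k" "l i \<le> l j" "\<And>k. k < N \<Longrightarrow> k \<noteq> i \<Longrightarrow> l j \<le> l k"
  shows "\<exists>es. sorted_list_of_multiset (image_mset (mode_energy N l) (mset_set {..<2 ^ N}))
     = mode_energy N l 0 # (mode_energy N l 0 + l i) # (mode_energy N l 0 + l j) # es"
proof -
  let ?mu = "mode_energy N l"
  define R where "R = {..<2 ^ N} - {0, 2 ^ i, 2 ^ j :: nat}"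
  define es where "es = sorted_list_of_multiset (image_mset ?mu (mset_set R))"
  have "2 ^ i \<noteq> (2 ^ j :: nat)" using ij by simp
  moreover have "{..<2 ^ N} = insert 0 (insert (2 ^ i) (insert (2 ^ j) R))"
    using ij by (auto simp: R_def)
  moreover have "finite R" "0 \<notin> R" "2 ^ i \<notin> R" "2 ^ j \<notin> R" by (auto simp: R_def)
  ultimately have "mset_set {..<2 ^ N :: nat} = {#0, 2 ^ i, 2 ^ j#} + mset_set R" by simp
  then have ms: "image_mset ?mu (mset_set {..<2 ^ N}) = mset (?mu 0 # (?mu 0 + l i) # (?mu 0 + l j) # es)"
    using ij by (simp add: mode_energy_power es_def)
  have ge: "?mu 0 + l j \<le> ?mu t" if t: "t \<in> R" for t
  proof -
    \<comment> \<open>Without such a bit, \<open>t\<close> would be \<open>0\<close> or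
      \<open>2 ^ i\<close>, and both are excluded from \<open>R\<close>.\<close>
    have "\<exists>k<N. k \<noteq> i \<and> bit t k"
    proof (rule ccontr)
      assume no: "\<not> (\<exists>k<N. k \<noteq> i \<and> bit t k)"
      have tN: "t < 2 ^ N" using t by (simp add: R_def)
      have "take_bit N t = take_bit N (if bit t i then 2 ^ i else 0)"
        using no by (intro bit_eqI) (auto simp: bit_take_bit_iff bit_exp_iff)
      moreover have "(if bit t i then 2 ^ i else 0 :: nat) < 2 ^ N" using ij by simp
      ultimately have "t = (if bit t i then 2 ^ i else 0)" using tN by (simp add: take_bit_nat_eq_self)
      then show False using t unfolding R_def by (metis DiffD2 insertCI)
    qed
    then obtain k where k: "k < N" "k \<noteq> i" "bit t k" by blast
    have "l j \<le> l k" using l(3) k by simp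
    also have "l k = (if bit t k then l k else 0)" using k by simp
    also have "\<dots> \<le> (\<Sum>k<N. if bit t k then l k else 0)"
      using k l(1) by (intro member_le_sum) auto
    finally show ?thesis by (subst mode_energy_eq[of N l t]) simp
  qed
  have "sorted (?mu 0 # (?mu 0 + l i) # (?mu 0 + l j) # es)"
  proof -
    have "?mu 0 + l j \<le> x" if "x \<in> set es" for x
      using that ge by (auto simp: es_def R_def)
    then have "?mu 0 \<le> x \<and> ?mu 0 + l i \<le> x \<and> ?mu 0 + l j \<le> x" if "x \<in> set es" for x
      using that l(2) l(1)[OF ij(1)] by fastforce
    moreover have "sorted es" by (simp add: es_def)
    ultimately show ?thesis using l(2) l(1)[OF ij(1)] l(1)[OF ij(2)] by simp
  qed
  then show ?thesis unfolding ms sorted_list_of_multiset_mset by (simp only: sorted_sort_id) blast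
qed

lemma exists_two_smallest:
  fixes l :: "nat \<Rightarrow> real"
  assumes "2 \<le> N"
  obtains i j where "i < N" "j < N" "i \<noteq> j" "l i \<le> l j" "\<And>k. k < N \<Longrightarrow> l i \<le> l k"
    "\<And>k. k < N \<Longrightarrow> k \<noteq> i \<Longrightarrow> l j \<le> l k"
proof -
  have min: "\<exists>i\<in>S. \<forall>k\<in>S. l i \<le> l k" if "finite S" "S \<noteq> {}" for S
    using that Min_in[of "l ` S"] Min_le[of "l ` S"] by fastforce
  obtain i where i: "i < N" "\<And>k. k < N \<Longrightarrow> l i \<le> l k"
    using min[of "{..<N}"] assms by (metis finite_lessThan lessThan_empty_iff lessThan_iff not_numeral_le_zero bot_nat_def)
  have "(if i = 0 then 1 else 0) \<in> {..<N} - {i}" using assms by auto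
  then have "{..<N} - {i} \<noteq> {}" by blast
  then obtain j where j: "j < N" "j \<noteq> i" "\<And>k. k < N \<Longrightarrow> k \<noteq> i \<Longrightarrow> l j \<le> l k"
    using min[of "{..<N} - {i}"] by auto
  show ?thesis using that[of i j] i j by metis
qed

theorem mainTheorem1:
  fixes r :: nat and eps :: real
  assumes "1 \<le> r" and "0 \<le> eps" and "eps < 1"
  shows "\<exists>N0. \<forall>N\<ge>N0. \<forall>V. perturbation N eps r V \<longrightarrow>
     (let E = sorted_eigenvalues (H0 N + Vhat N V) in
        E ! 1 - E ! 0 \<le> (2 * eps / (1 + eps)) powr (real N / (2 * real r)) \<and>
        E ! 2 - E ! 1 \<ge> 1 - eps - (2 * eps / (1 + eps)) powr (real N / (2 * real r)))"
\<comment> \<open>The estimates hold from \<open>N = 2\<close> on: there are then two modes to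
  compare and at least four energies, so the first three list entries exist.\<close>
proof (intro exI[of _ 2] allI impI)
  fix N V assume N: "2 \<le> N" and pert: "perturbation N eps r V"
  let ?n = "2 * N"
  define W where "W p q = V $$ (p, q)" for p q
  define A where "A p q = chain ?n p q + W p q" for p q
  have V: "V \<in> carrier_mat ?n ?n" "op_norm V \<le> eps" using pert by (auto simp: perturbation_def)
  have W: "antisym_mat ?n W" using pert unfolding perturbation_def antisym_mat_def W_def by blast
  have range: "W p q = 0" if "p < ?n" "q < ?n" "q + r < p" for p q
  proof -
    have "r < nat \<bar>int p - int q\<bar>" using that(3) by simp
    then show ?thesis using pert that(1,2) unfolding perturbation_def W_def by blast
  qed
  have bound: "ip ?n (mv ?n W x) (mv ?n W x) \<le> eps\<^sup>2 * ip ?n x x" for x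
    unfolding W_def by (rule op_norm_bound[OF V])
  have A: "antisym_mat ?n A"
    unfolding antisym_mat_def
  proof (intro allI impI)
    fix p q assume "p < ?n" "q < ?n"
    then have "chain ?n p q = - chain ?n q p" "W p q = - W q p"
      using antisym_mat_chain[of ?n] W unfolding antisym_mat_def by blast+
    then show "A p q = - A q p" unfolding A_def by linarith
  qed
  obtain F l where F: "orthonormal ?n ?n F" and l: "\<And>i. i < N \<Longrightarrow> 0 \<le> l i"
    and dec: "\<And>p q. p < ?n \<Longrightarrow> q < ?n \<Longrightarrow>
       A p q = (\<Sum>i<N. l i * (F (2 * i + 1) p * F (2 * i) q - F (2 * i) p * F (2 * i + 1) q))"
    and mvs: "\<And>i p. i < N \<Longrightarrow> p < ?n \<Longrightarrow> mv ?n A (F (2 * i)) p = l i * F (2 * i + 1) p"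
      "\<And>i p. i < N \<Longrightarrow> p < ?n \<Longrightarrow> mv ?n A (F (2 * i + 1)) p = - l i * F (2 * i) p"
    using antisym_canonical_form[OF A] by blast
  interpret antisym_canonical N A F l
    by unfold_locales (use A F l mvs in auto)
  obtain i j where ij: "i < N" "j < N" "i \<noteq> j" "l i \<le> l j" "\<And>k. k < N \<Longrightarrow> l i \<le> l k"
    "\<And>k. k < N \<Longrightarrow> k \<noteq> i \<Longrightarrow> l j \<le> l k" using exists_two_smallest[OF N] by metis
  \<comment> \<open>The largest \<open>m\<close> with \<open>m * (r + 1) < 2 * N\<close>;
    subtracting 1 makes the inequality strict.\<close>
  define m where "m = (?n - 1) div (r + 1)"
  have m1: "m * (r + 1) < ?n" using N div_times_less_eq_dividend[of "?n - 1" "r + 1"] by (simp add: m_def)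
  have m2: "?n \<le> (m + 1) * (r + 1)"
    using dividend_less_div_times[of "r + 1" "?n - 1"] by (simp add: m_def)
  obtain u where u: "1 \<le> ip ?n u u" "ip ?n (mv ?n A u) (mv ?n A u) \<le> (eps ^ (m + 1))\<^sup>2"
    using edge_mode[of ?n W r eps m] N W range bound m1 unfolding A_def by auto
  have "(l i)\<^sup>2 * 1 \<le> (l i)\<^sup>2 * ip ?n u u" using u(1) by (intro mult_left_mono) auto
  also have "\<dots> \<le> ip ?n (mv ?n A u) (mv ?n A u)" using ij l by (intro ip_mv_ge) auto
  finally have "(l i)\<^sup>2 \<le> (eps ^ (m + 1))\<^sup>2" using u(2) by simp
  then have "l i \<le> eps ^ (m + 1)" by (rule power2_le_imp_le) (simp add: assms(2))
  also have "\<dots> \<le> (2 * eps / (1 + eps)) powr (real N / (2 * real r))"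
    by (rule power_le_powr_edge[OF assms m2])
  finally have li: "l i \<le> (2 * eps / (1 + eps)) powr (real N / (2 * real r))" .
  have lj: "1 - eps \<le> l j"
    by (rule second_singular_value_ge[OF ij(1-4) _ bound assms(2)]) (simp add: A_def)
  have "sorted_eigenvalues (H0 N + Vhat N V)
     = sorted_list_of_multiset (image_mset (mode_energy N l) (mset_set {..<2 ^ N}))"
    using dec by (intro sorted_eigenvalues_hamiltonian[OF F]) (simp add: A_def W_def)
  \<comment> \<open>The first two gaps can now be read off as \<open>l i\<close> and
    \<open>l j - l i\<close>.\<close>
  moreover obtain es where "sorted_list_of_multiset (image_mset (mode_energy N l) (mset_set {..<2 ^ N}))
     = mode_energy N l 0 # (mode_energy N l 0 + l i) # (mode_energy N l 0 + l j) # es"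
    using three_lowest_energies[of i N j l] ij l by blast
  ultimately show "let E = sorted_eigenvalues (H0 N + Vhat N V) in
        E ! 1 - E ! 0 \<le> (2 * eps / (1 + eps)) powr (real N / (2 * real r)) \<and>
        E ! 2 - E ! 1 \<ge> 1 - eps - (2 * eps / (1 + eps)) powr (real N / (2 * real r))"
    using li lj by (simp add: Let_def)
qed

end
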